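(* Let $p,q\in(1,\infty)$ with $\frac1p+\frac1q<1$ and let $Q\in\mathrm{L}^\infty(\mathbf{R}^d)\cap\mathrm{VMO}(\mathbf{R}^d)$. Put $q(x;\lambda,\eta):=Q(x)\lambda\overline\eta$ for $\lambda,\eta\in\mathbf{C}$. Assume that $(u_n)$ is bounded in $\mathrm{L}^p(\mathbf{R}^d)$ with $u_n\rightharpoonup u$ weakly, and $(v_n)$ is bounded in $\mathrm{L}^q(\mathbf{R}^d)$ with $v_n\rightharpoonup v$ weakly. If $q(x;u_n,v_n)\to\omega$ in the sense of distributions $\mathcal{D}'(\mathbf{R}^d)$, and $D$ is the H-distribution associated (along a subsequence) with $(u_n-u)$ and $(v_n-v)$, then for every $\phi\in\mathrm{C}_c^\infty(\mathbf{R}^d)$ $$\langle\omega-q(x;u,v),\phi\rangle=D(Q\phi,1),$$ where $1$ denotes the constant symbol on $\mathrm{S}^{d-1}$.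
   Context: Functions are complex-valued; $\langle\cdot,\cdot\rangle$ is the bilinear distributional pairing (so $\langle f,\phi\rangle=\int f\phi\,dx$ for $f\in\mathrm{L}^1_{loc}$). $\mathrm{VMO}(\mathbf{R}^d)$ is the closure of $\mathrm{C}_c(\mathbf{R}^d)$ in the norm $\|f\|_{\mathrm{BMO}}=\sup_B\frac1{|B|}\int_B|f-f_B|\,dx$ (sup over balls, $f_B$ the mean). $\mathrm{VMO}_c(\mathbf{R}^d)=\bigcup_n\mathrm{VMO}_{K_n}(\mathbf{R}^d)$ is the set of compactly supported $\mathrm{VMO}(\mathbf{R}^d)$ functions, with the strict inductive limit topology of the Banach spaces $\mathrm{VMO}_{K_n}=\{\varphi\in\mathrm{VMO}:\operatorname{supp}\varphi\subseteq K_n\}$ ($\mathrm{BMO}$ norm), $(K_n)$ a compact exhaustion of $\mathbf{R}^d$; $\mathrm{L}^\infty\cap\mathrm{VMO}_c$ carries the induced topology. $\kappa$ is the least integer $>d/2$. For $\psi\in\mathrm{C}^\kappa(\mathrm{S}^{d-1})$, $\mathcal{A}_\psi u=\mathcal{F}^{-1}(\psi(\xi/|\xi|)\hat u)$, bounded on $\mathrm{L}^s(\mathbf{R}^d)$, $1<s<\infty$. H-distribution: for $U_n\rightharpoonup0$ in $\mathrm{L}^p$, $V_n\rightharpoonup0$ in $\mathrm{L}^q$, $\frac1p+\frac1q<1$, after passing to a subsequence there is a jointly continuous bilinear functional $D$ on $(\mathrm{L}^\infty\cap\mathrm{VMO}_c)\times\mathrm{C}^\kappa(\mathrm{S}^{d-1})$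 with $D(\varphi_1\overline{\varphi_2},\psi)=\lim_n\int_{\mathbf{R}^d}\mathcal{A}_\psi(\varphi_1U_n)\overline{\varphi_2V_n}\,dx$ for all $\varphi_1,\varphi_2\in\mathrm{L}^\infty\cap\mathrm{VMO}_c$, $\psi\in\mathrm{C}^\kappa(\mathrm{S}^{d-1})$. This $D$ is the H-distribution associated with $(U_n),(V_n)$ along that subsequence. *)

theory Defs
  imports "HOL-Analysis.Analysis"
begin

text \<open>
  Elements of Lebesgue, BMO and VMO spaces are represented by Borel functions (not by classes modulo
  equality almost everywhere), so these spaces carry seminorms rather than norms.
\<close>

section \<open>Differentiability of finite order, test functions, distributions\<close>

primrec Ck_on :: "nat \<Rightarrow> 'a::euclidean_space set \<Rightarrow> ('a \<Rightarrow> complex) \<Rightarrow> bool" where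
  "Ck_on 0 S f \<longleftrightarrow> continuous_on S f"
| "Ck_on (Suc k) S f \<longleftrightarrow>
     f differentiable_on S \<and> (\<forall>v. Ck_on k S (\<lambda>x. frechet_derivative f (at x) v))"

text \<open>
  The function \<open>Ck_on k S\<close> is used for open \<open>S\<close> only. A list of basis vectors plays the role of a
  multi-index; mixed partial derivatives are simply counted several times in the seminorm below.
\<close>

primrec iter_deriv :: "'a::euclidean_space list \<Rightarrow> ('a \<Rightarrow> complex) \<Rightarrow> 'a \<Rightarrow> complex" where
  "iter_deriv [] f = f"
| "iter_deriv (v # vs) f = (\<lambda>x. frechet_derivative (iter_deriv vs f) (at x) v)"

definition Ck_seminorm :: "nat \<Rightarrow> 'a::euclidean_space set \<Rightarrow> ('a \<Rightarrow> complex) \<Rightarrow> real" where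
  "Ck_seminorm k S f =
     (\<Sum>vs\<in>{vs. set vs \<subseteq> Basis \<and> length vs \<le> k}. SUP x\<in>S. norm (iter_deriv vs f x))"

definition Cc :: "('a::euclidean_space \<Rightarrow> complex) set" where
  "Cc = {f. continuous_on UNIV f \<and> compact (closure {x. f x \<noteq> 0})}"

definition test_functions :: "('a::euclidean_space \<Rightarrow> complex) set" where
  "test_functions = {\<phi>. (\<forall>k. Ck_on k UNIV \<phi>) \<and> compact (closure {x. \<phi> x \<noteq> 0})}"

definition distribution :: "(('a::euclidean_space \<Rightarrow> complex) \<Rightarrow> complex) \<Rightarrow> bool" where
  "distribution \<omega> \<longleftrightarrow>
     (\<forall>\<phi>\<in>test_functions. \<forall>\<psi>\<in>test_functions. \<forall>a b.
        \<omega> (\<lambda>x. a * \<phi> x + b * \<psi> x) = a * \<omega> \<phi> + b * \<omega> \<psi>) \<and>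
     (\<forall>K. compact K \<longrightarrow> (\<exists>C N. \<forall>\<phi>\<in>test_functions. closure {x. \<phi> x \<noteq> 0} \<subseteq> K \<longrightarrow>
        norm (\<omega> \<phi>) \<le> C * Ck_seminorm N UNIV \<phi>))"

definition pairing :: "('a::euclidean_space \<Rightarrow> complex) \<Rightarrow> ('a \<Rightarrow> complex) \<Rightarrow> complex" where
  "pairing f \<phi> = (LINT x|lborel. f x * \<phi> x)"

definition tendsto_distribution ::
    "(nat \<Rightarrow> 'a::euclidean_space \<Rightarrow> complex) \<Rightarrow> (('a \<Rightarrow> complex) \<Rightarrow> complex) \<Rightarrow> bool" where
  "tendsto_distribution f \<omega> \<longleftrightarrow>
     (\<forall>\<phi>\<in>test_functions. (\<lambda>n. pairing (f n) \<phi>) \<longlonglongrightarrow> \<omega> \<phi>)"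

section \<open>Lebesgue spaces\<close>

definition Lp :: "real \<Rightarrow> ('a::euclidean_space \<Rightarrow> complex) set" where
  "Lp p = {f. f \<in> borel_measurable lborel \<and> integrable lborel (\<lambda>x. norm (f x) powr p)}"

definition Lp_norm :: "real \<Rightarrow> ('a::euclidean_space \<Rightarrow> complex) \<Rightarrow> real" where
  "Lp_norm p f = (LINT x|lborel. norm (f x) powr p) powr (1 / p)"

definition Linf :: "('a::euclidean_space \<Rightarrow> complex) set" where
  "Linf = {f. f \<in> borel_measurable lborel \<and> (\<exists>C. AE x in lborel. norm (f x) \<le> C)}"

definition Lp_bounded :: "real \<Rightarrow> (nat \<Rightarrow> 'a::euclidean_space \<Rightarrow> complex) \<Rightarrow> bool" where
  "Lp_bounded p u \<longleftrightarrow> (\<forall>n. u n \<in> Lp p) \<and> (\<exists>C. \<forall>n. Lp_norm p (u n) \<le> C)"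

text \<open>Weak convergence, with the dual of \<open>L\<^sup>p\<close> (\<open>1 < p < \<infinity>\<close>) identified with \<open>L\<^sup>p'\<close>, \<open>p' = p / (p - 1)\<close>.\<close>

definition Lp_weakly_tendsto ::
    "real \<Rightarrow> (nat \<Rightarrow> 'a::euclidean_space \<Rightarrow> complex) \<Rightarrow> ('a \<Rightarrow> complex) \<Rightarrow> bool" where
  "Lp_weakly_tendsto p u u0 \<longleftrightarrow> (\<forall>n. u n \<in> Lp p) \<and> u0 \<in> Lp p \<and>
     (\<forall>g\<in>Lp (p / (p - 1)). (\<lambda>n. LINT x|lborel. u n x * g x) \<longlonglongrightarrow> (LINT x|lborel. u0 x * g x))"

text \<open>Strong convergence, expressed by the nonnegative integral so that no integrability of the
  differences has to be presupposed.\<close>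

definition Lp_tendsto ::
    "real \<Rightarrow> (nat \<Rightarrow> 'a::euclidean_space \<Rightarrow> complex) \<Rightarrow> ('a \<Rightarrow> complex) \<Rightarrow> bool" where
  "Lp_tendsto s w w0 \<longleftrightarrow>
     (\<lambda>n. \<integral>\<^sup>+x. ennreal (norm (w n x - w0 x) powr s) \<partial>lborel) \<longlonglongrightarrow> 0"

section \<open>BMO and VMO\<close>

definition mean :: "('a::euclidean_space \<Rightarrow> complex) \<Rightarrow> 'a set \<Rightarrow> complex" where
  "mean f B = (LINT x:B|lborel. f x) /\<^sub>R measure lborel B"

definition mean_oscillation :: "('a::euclidean_space \<Rightarrow> complex) \<Rightarrow> 'a set \<Rightarrow> real" where
  "mean_oscillation f B = (LINT x:B|lborel. norm (f x - mean f B)) / measure lborel B"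

definition L1_loc :: "('a::euclidean_space \<Rightarrow> complex) set" where
  "L1_loc = {f. f \<in> borel_measurable lborel \<and> (\<forall>K. compact K \<longrightarrow> set_integrable lborel K f)}"

definition BMO_norm :: "('a::euclidean_space \<Rightarrow> complex) \<Rightarrow> ennreal" where
  "BMO_norm f = (SUP (c, r)\<in>UNIV \<times> {0<..}. ennreal (mean_oscillation f (ball c r)))"

definition BMO :: "('a::euclidean_space \<Rightarrow> complex) set" where
  "BMO = {f \<in> L1_loc. BMO_norm f < \<infinity>}"

definition VMO :: "('a::euclidean_space \<Rightarrow> complex) set" where
  "VMO = {f \<in> BMO. \<forall>\<epsilon>>0. \<exists>g\<in>Cc. BMO_norm (\<lambda>x. f x - g x) < \<epsilon>}"

text \<open>The support of a function regarded as a class modulo equality almost everywhere.\<close>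

definition ess_supp :: "('a::euclidean_space \<Rightarrow> complex) \<Rightarrow> 'a set" where
  "ess_supp f = - \<Union>{U. open U \<and> (AE x in lborel. x \<in> U \<longrightarrow> f x = 0)}"

definition VMO_on :: "'a::euclidean_space set \<Rightarrow> ('a \<Rightarrow> complex) set" where
  "VMO_on K = {f \<in> VMO. ess_supp f \<subseteq> K}"

definition compact_exhaustion :: "(nat \<Rightarrow> 'a::euclidean_space set) \<Rightarrow> bool" where
  "compact_exhaustion K \<longleftrightarrow>
     (\<forall>n. compact (K n)) \<and> (\<forall>n. K n \<subseteq> interior (K (Suc n))) \<and> (\<Union>n. K n) = UNIV"

definition VMO_c :: "(nat \<Rightarrow> 'a::euclidean_space set) \<Rightarrow> ('a \<Rightarrow> complex) set" where
  "VMO_c K = (\<Union>n. VMO_on (K n))"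

text \<open>
  The inductive limit topology is the finest locally convex topology for which all inclusions of
  the spaces \<open>VMO_on (K n)\<close> are continuous. Its basic neighbourhoods of the origin are the
  absolutely convex sets that meet every step in a neighbourhood of the origin of that step.
\<close>

definition VMO_c_nhds0 :: "(nat \<Rightarrow> 'a::euclidean_space set) \<Rightarrow> ('a \<Rightarrow> complex) set set" where
  "VMO_c_nhds0 K = {U. U \<subseteq> VMO_c K \<and>
     (\<forall>f\<in>U. \<forall>g\<in>U. \<forall>a b. norm a + norm b \<le> 1 \<longrightarrow> (\<lambda>x. a * f x + b * g x) \<in> U) \<and>
     (\<forall>n. \<exists>\<epsilon>>0. {f \<in> VMO_on (K n). BMO_norm f < \<epsilon>} \<subseteq> U)}"

definition VMO_c_topology :: "(nat \<Rightarrow> 'a::euclidean_space set) \<Rightarrow> ('a \<Rightarrow> complex) topology" where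
  "VMO_c_topology K = topology (\<lambda>W. W \<subseteq> VMO_c K \<and>
     (\<forall>f\<in>W. \<exists>U\<in>VMO_c_nhds0 K. {\<lambda>x. f x + g x |g. g \<in> U} \<subseteq> W))"

lemma VMO_c_nhds0_Int:
  assumes U: "U \<in> VMO_c_nhds0 K" and V: "V \<in> VMO_c_nhds0 K"
  shows "U \<inter> V \<in> VMO_c_nhds0 K"
proof -
  have "\<exists>\<epsilon>>0. {f \<in> VMO_on (K n). BMO_norm f < \<epsilon>} \<subseteq> U \<inter> V" for n
  proof -
    obtain d where d: "d > 0" "{f \<in> VMO_on (K n). BMO_norm f < d} \<subseteq> U"
      using U unfolding VMO_c_nhds0_def by blast
    obtain e where e: "e > 0" "{f \<in> VMO_on (K n). BMO_norm f < e} \<subseteq> V"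
      using V unfolding VMO_c_nhds0_def by blast
    show ?thesis
      using d e by (intro exI[of _ "min d e"]) auto
  qed
  then show ?thesis
    using U V unfolding VMO_c_nhds0_def by blast
qed

lemma openin_VMO_c_topology:
  "openin (VMO_c_topology K) W \<longleftrightarrow> W \<subseteq> VMO_c K \<and>
     (\<forall>f\<in>W. \<exists>U\<in>VMO_c_nhds0 K. {\<lambda>x. f x + g x |g. g \<in> U} \<subseteq> W)"
proof -
  have "istopology (\<lambda>W. W \<subseteq> VMO_c K \<and>
     (\<forall>f\<in>W. \<exists>U\<in>VMO_c_nhds0 K. {\<lambda>x. f x + g x |g. g \<in> U} \<subseteq> W))"
    unfolding istopology_def
  proof (intro conjI allI impI)
    fix S T
    assume S: "S \<subseteq> VMO_c K \<and> (\<forall>f\<in>S. \<exists>U\<in>VMO_c_nhds0 K. {\<lambda>x. f x + g x |g. g \<in> U} \<subseteq> S)"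
      and T: "T \<subseteq> VMO_c K \<and> (\<forall>f\<in>T. \<exists>U\<in>VMO_c_nhds0 K. {\<lambda>x. f x + g x |g. g \<in> U} \<subseteq> T)"
    show "S \<inter> T \<subseteq> VMO_c K" using S by blast
    show "\<forall>f\<in>S \<inter> T. \<exists>U\<in>VMO_c_nhds0 K. {\<lambda>x. f x + g x |g. g \<in> U} \<subseteq> S \<inter> T"
    proof
      fix f assume f: "f \<in> S \<inter> T"
      obtain U where U: "U \<in> VMO_c_nhds0 K" "{\<lambda>x. f x + g x |g. g \<in> U} \<subseteq> S"
        using S f by blast
      obtain V where V: "V \<in> VMO_c_nhds0 K" "{\<lambda>x. f x + g x |g. g \<in> V} \<subseteq> T"
        using T f by blast
      show "\<exists>U\<in>VMO_c_nhds0 K. {\<lambda>x. f x + g x |g. g \<in> U} \<subseteq> S \<inter> T"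
        using U V by (intro bexI[OF _ VMO_c_nhds0_Int[OF U(1) V(1)]]) blast
    qed
  next
    fix \<W>
    assume *: "\<forall>W\<in>\<W>. W \<subseteq> VMO_c K \<and>
      (\<forall>f\<in>W. \<exists>U\<in>VMO_c_nhds0 K. {\<lambda>x. f x + g x |g. g \<in> U} \<subseteq> W)"
    then show "\<Union>\<W> \<subseteq> VMO_c K" by blast
    show "\<forall>f\<in>\<Union>\<W>. \<exists>U\<in>VMO_c_nhds0 K. {\<lambda>x. f x + g x |g. g \<in> U} \<subseteq> \<Union>\<W>"
      using * by (meson Union_iff Union_upper order_trans)
  qed
  then show ?thesis
    unfolding VMO_c_topology_def by (simp add: topology_inverse')
qed

section \<open>Symbols on the unit sphere and Fourier multipliers\<close>

text \<open>
  A symbol is a function of which only the values on the unit sphere matter. Smoothness on the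
  sphere and the norm of \<open>C\<^sup>k(S)\<close> are expressed through the extension that is homogeneous of degree
  zero; this also covers dimension one, where the sphere consists of two points.
\<close>

definition homogeneous_ext :: "('a::euclidean_space \<Rightarrow> complex) \<Rightarrow> 'a \<Rightarrow> complex" where
  "homogeneous_ext \<psi> \<xi> = \<psi> (\<xi> /\<^sub>R norm \<xi>)"

definition Ck_sphere :: "nat \<Rightarrow> ('a::euclidean_space \<Rightarrow> complex) set" where
  "Ck_sphere k = {\<psi>. Ck_on k (- {0}) (homogeneous_ext \<psi>)}"

definition Ck_sphere_norm :: "nat \<Rightarrow> ('a::euclidean_space \<Rightarrow> complex) \<Rightarrow> real" where
  "Ck_sphere_norm k \<psi> = Ck_seminorm k (sphere 0 1) (homogeneous_ext \<psi>)"

definition Ck_sphere_topology :: "nat \<Rightarrow> ('a::euclidean_space \<Rightarrow> complex) topology" where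
  "Ck_sphere_topology k = topology (\<lambda>W. W \<subseteq> Ck_sphere k \<and>
     (\<forall>\<psi>\<in>W. \<exists>\<epsilon>>0. {\<theta> \<in> Ck_sphere k. Ck_sphere_norm k (\<lambda>\<xi>. \<theta> \<xi> - \<psi> \<xi>) < \<epsilon>} \<subseteq> W))"

lemma openin_Ck_sphere_topology:
  fixes W :: "('a::euclidean_space \<Rightarrow> complex) set"
  shows "openin (Ck_sphere_topology k) W \<longleftrightarrow> W \<subseteq> Ck_sphere k \<and>
     (\<forall>\<psi>\<in>W. \<exists>\<epsilon>>0. {\<theta> \<in> Ck_sphere k. Ck_sphere_norm k (\<lambda>\<xi>. \<theta> \<xi> - \<psi> \<xi>) < \<epsilon>} \<subseteq> W)"
proof -
  let ?B = "\<lambda>(\<psi> :: 'a \<Rightarrow> complex) \<epsilon>. {\<theta> \<in> Ck_sphere k. Ck_sphere_norm k (\<lambda>\<xi>. \<theta> \<xi> - \<psi> \<xi>) < \<epsilon>}"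
  have "istopology (\<lambda>W. W \<subseteq> Ck_sphere k \<and> (\<forall>\<psi>\<in>W. \<exists>\<epsilon>>0. ?B \<psi> \<epsilon> \<subseteq> W))"
    unfolding istopology_def
  proof (intro conjI allI impI)
    fix S T
    assume S: "S \<subseteq> Ck_sphere k \<and> (\<forall>\<psi>\<in>S. \<exists>\<epsilon>>0. ?B \<psi> \<epsilon> \<subseteq> S)"
      and T: "T \<subseteq> Ck_sphere k \<and> (\<forall>\<psi>\<in>T. \<exists>\<epsilon>>0. ?B \<psi> \<epsilon> \<subseteq> T)"
    show "S \<inter> T \<subseteq> Ck_sphere k" using S by blast
    show "\<forall>\<psi>\<in>S \<inter> T. \<exists>\<epsilon>>0. ?B \<psi> \<epsilon> \<subseteq> S \<inter> T"
    proof
      fix \<psi> assume f: "\<psi> \<in> S \<inter> T"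
      obtain d where d: "d > 0" "?B \<psi> d \<subseteq> S" using S f by blast
      obtain e where e: "e > 0" "?B \<psi> e \<subseteq> T" using T f by blast
      show "\<exists>\<epsilon>>0. ?B \<psi> \<epsilon> \<subseteq> S \<inter> T"
        using d e by (intro exI[of _ "min d e"]) auto
    qed
  next
    fix \<W>
    assume *: "\<forall>W\<in>\<W>. W \<subseteq> Ck_sphere k \<and> (\<forall>\<psi>\<in>W. \<exists>\<epsilon>>0. ?B \<psi> \<epsilon> \<subseteq> W)"
    then show "\<Union>\<W> \<subseteq> Ck_sphere k" by blast
    show "\<forall>\<psi>\<in>\<Union>\<W>. \<exists>\<epsilon>>0. ?B \<psi> \<epsilon> \<subseteq> \<Union>\<W>"
      using * by (meson Union_iff Union_upper order_trans)
  qed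
  then show ?thesis
    unfolding Ck_sphere_topology_def by (simp add: topology_inverse')
qed

definition fourier :: "('a::euclidean_space \<Rightarrow> complex) \<Rightarrow> 'a \<Rightarrow> complex" where
  "fourier u \<xi> = (LINT x|lborel. cis (- 2 * pi * (x \<bullet> \<xi>)) * u x)"

definition inv_fourier :: "('a::euclidean_space \<Rightarrow> complex) \<Rightarrow> 'a \<Rightarrow> complex" where
  "inv_fourier h x = (LINT \<xi>|lborel. cis (2 * pi * (x \<bullet> \<xi>)) * h \<xi>)"

text \<open>
  Functions for which \<open>\<F>\<^sup>-\<^sup>1 (\<psi>(\<xi>/|\<xi>|) \<F> u)\<close> is given by absolutely convergent integrals. They contain
  the Schwartz functions and are bounded up to null sets, so they lie in \<open>L\<^sup>2\<close> and in every \<open>L\<^sup>s\<close>, in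
  which they are dense for \<open>1 < s < \<infinity>\<close>. As \<open>\<A>\<^sub>\<psi>\<close> is bounded on \<open>L\<^sup>s\<close>, its action on \<open>L\<^sup>s\<close> is the
  continuous extension from this core.
\<close>

definition fourier_core :: "('a::euclidean_space \<Rightarrow> complex) set" where
  "fourier_core = {u. integrable lborel u \<and> integrable lborel (fourier u)}"

definition is_multiplier_image ::
    "real \<Rightarrow> ('a::euclidean_space \<Rightarrow> complex) \<Rightarrow> ('a \<Rightarrow> complex) \<Rightarrow> ('a \<Rightarrow> complex) \<Rightarrow> bool" where
  "is_multiplier_image s \<psi> u w \<longleftrightarrow> w \<in> Lp s \<and>
     (\<exists>f. (\<forall>n. f n \<in> fourier_core) \<and> Lp_tendsto s f u \<and>
       Lp_tendsto s (\<lambda>n. inv_fourier (\<lambda>\<xi>. homogeneous_ext \<psi> \<xi> * fourier (f n) \<xi>)) w)"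

text \<open>The operator \<open>\<A>\<^sub>\<psi>\<close> on \<open>L\<^sup>s\<close>; its value is determined up to equality almost everywhere.\<close>

definition multiplier_op ::
    "real \<Rightarrow> ('a::euclidean_space \<Rightarrow> complex) \<Rightarrow> ('a \<Rightarrow> complex) \<Rightarrow> 'a \<Rightarrow> complex" where
  "multiplier_op s \<psi> u = (SOME w. is_multiplier_image s \<psi> u w)"

section \<open>H-distributions\<close>

definition kappa :: "'a::euclidean_space itself \<Rightarrow> nat" where
  "kappa _ = (LEAST k. real k > real DIM('a) / 2)"

text \<open>
  The functional is relevant on \<open>(Linf \<inter> VMO_c K) \<times> Ck_sphere \<kappa>\<close> only. Continuity into a Hausdorff
  space makes it insensitive to changes on null sets in the first argument and off the sphere in
  the second one.
\<close>

definition jointly_continuous_bilinear ::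
    "(nat \<Rightarrow> 'a::euclidean_space set) \<Rightarrow> (('a \<Rightarrow> complex) \<Rightarrow> ('a \<Rightarrow> complex) \<Rightarrow> complex) \<Rightarrow> bool" where
  "jointly_continuous_bilinear K D \<longleftrightarrow>
     (\<forall>\<psi>\<in>Ck_sphere (kappa TYPE('a)). \<forall>f\<in>Linf \<inter> VMO_c K. \<forall>g\<in>Linf \<inter> VMO_c K. \<forall>a b.
        D (\<lambda>x. a * f x + b * g x) \<psi> = a * D f \<psi> + b * D g \<psi>) \<and>
     (\<forall>f\<in>Linf \<inter> VMO_c K. \<forall>\<psi>\<in>Ck_sphere (kappa TYPE('a)). \<forall>\<theta>\<in>Ck_sphere (kappa TYPE('a)). \<forall>a b.
        D f (\<lambda>\<xi>. a * \<psi> \<xi> + b * \<theta> \<xi>) = a * D f \<psi> + b * D f \<theta>) \<and>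
     continuous_map
       (prod_topology (subtopology (VMO_c_topology K) (Linf \<inter> VMO_c K))
                      (Ck_sphere_topology (kappa TYPE('a))))
       euclidean (\<lambda>(f, \<psi>). D f \<psi>)"

text \<open>
  Here \<open>U\<close> is a sequence in \<open>L\<^sup>p\<close> converging weakly to zero, \<open>V\<close> one in \<open>L\<^sup>q\<close>, and both have already been
  restricted to the subsequence along which \<open>D\<close> is obtained.
\<close>

definition H_distribution ::
    "real \<Rightarrow> real \<Rightarrow> (nat \<Rightarrow> 'a::euclidean_space set) \<Rightarrow>
     (nat \<Rightarrow> 'a \<Rightarrow> complex) \<Rightarrow> (nat \<Rightarrow> 'a \<Rightarrow> complex) \<Rightarrow>
     (('a \<Rightarrow> complex) \<Rightarrow> ('a \<Rightarrow> complex) \<Rightarrow> complex) \<Rightarrow> bool" where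
  "H_distribution p q K U V D \<longleftrightarrow>
     Lp_weakly_tendsto p U (\<lambda>_. 0) \<and> Lp_weakly_tendsto q V (\<lambda>_. 0) \<and>
     jointly_continuous_bilinear K D \<and>
     (\<forall>\<phi>\<^sub>1\<in>Linf \<inter> VMO_c K. \<forall>\<phi>\<^sub>2\<in>Linf \<inter> VMO_c K. \<forall>\<psi>\<in>Ck_sphere (kappa TYPE('a)).
        (\<lambda>n. LINT x|lborel. multiplier_op p \<psi> (\<lambda>x. \<phi>\<^sub>1 x * U n x) x * cnj (\<phi>\<^sub>2 x * V n x))
          \<longlonglongrightarrow> D (\<lambda>x. \<phi>\<^sub>1 x * cnj (\<phi>\<^sub>2 x)) \<psi>)"

definition qform :: "('a::euclidean_space \<Rightarrow> complex) \<Rightarrow> 'a \<Rightarrow> complex \<Rightarrow> complex \<Rightarrow> complex" where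
  "qform Q x \<mu> \<eta> = Q x * \<mu> * cnj \<eta>"

end

theory Submission
  imports Defs "HOL-Probability.Characteristic_Functions"
begin

text \<open>
  Test the H-distribution with \<open>\<phi>\<^sub>1 = Q \<phi>\<close> and with a continuous real cutoff \<open>\<phi>\<^sub>2\<close> that equals one on the
  support of \<open>\<phi>\<close>. As \<open>\<A>\<^sub>1\<close> is the identity, \<open>D(Q \<phi>, 1)\<close> is the limit of
  \<open>\<integral> Q \<phi> (u\<^sub>n - u) cnj (v\<^sub>n - v)\<close> along the subsequence; expanding the product and using weak convergence in
  the mixed terms gives \<open>\<omega> \<phi> - \<integral> Q \<phi> u cnj v\<close>.

  Two facts need work. First, \<open>\<A>\<^sub>1\<close> is defined by density from absolutely convergent Fourier integrals, so
  that \<open>\<A>\<^sub>1 f = f\<close> amounts to Fourier inversion almost everywhere and to the density of the core in \<open>L\<^sup>p\<close>;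
  both follow from Gaussian mollification. Second, \<open>Q \<phi>\<close> has to lie in VMO: if \<open>g \<in> C\<^sub>c\<close> is close to \<open>Q\<close> in
  BMO and \<open>a\<close> is the mean of \<open>Q - g\<close> over a large ball, then \<open>(g + a) \<phi>\<close> is close to \<open>Q \<phi>\<close>, because the
  means of \<open>Q - g - a\<close> over balls of radius \<open>r\<close> grow only like \<open>log (1 / r)\<close>, while the Lipschitz function
  \<open>\<phi>\<close> oscillates there by \<open>O(r)\<close>.
\<close>

section \<open>Density of continuous functions in Lebesgue spaces\<close>

lemma norm_add_powr_le:
  fixes a b :: "'b::real_normed_vector" and p :: real
  assumes "p \<ge> 0"
  shows "norm (a + b) powr p \<le> 2 powr p * (norm a powr p + norm b powr p)"
proof -
  have "norm (a + b) powr p \<le> (2 * max (norm a) (norm b)) powr p"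
    using assms by (intro powr_mono2) (auto intro: order_trans[OF norm_triangle_ineq])
  also have "\<dots> = 2 powr p * max (norm a) (norm b) powr p"
    by (subst powr_mult) auto
  also have "max (norm a) (norm b) powr p \<le> norm a powr p + norm b powr p"
    by (auto simp: max_def)
  finally show ?thesis by simp
qed

lemma nn_integral_powr_triangle:
  fixes f g h :: "'b \<Rightarrow> complex"
  assumes p: "p \<ge> 0" and [measurable]: "f \<in> borel_measurable M" "g \<in> borel_measurable M"
    "h \<in> borel_measurable M"
  shows "(\<integral>\<^sup>+x. ennreal (norm (f x - h x) powr p) \<partial>M) \<le>
     ennreal (2 powr p) * ((\<integral>\<^sup>+x. ennreal (norm (f x - g x) powr p) \<partial>M) +
       (\<integral>\<^sup>+x. ennreal (norm (g x - h x) powr p) \<partial>M))"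
proof -
  have "(\<integral>\<^sup>+x. ennreal (norm (f x - h x) powr p) \<partial>M) \<le>
    (\<integral>\<^sup>+x. ennreal (2 powr p) * (ennreal (norm (f x - g x) powr p) + ennreal (norm (g x - h x) powr p)) \<partial>M)"
  proof (rule nn_integral_mono)
    fix x
    have "norm (f x - h x) powr p \<le> 2 powr p * (norm (f x - g x) powr p + norm (g x - h x) powr p)"
      using norm_add_powr_le[OF p, of "f x - g x" "g x - h x"] by simp
    then show "ennreal (norm (f x - h x) powr p) \<le>
        ennreal (2 powr p) * (ennreal (norm (f x - g x) powr p) + ennreal (norm (g x - h x) powr p))"
      by (simp flip: ennreal_mult ennreal_plus)
  qed
  also have "\<dots> = ennreal (2 powr p) * ((\<integral>\<^sup>+x. ennreal (norm (f x - g x) powr p) \<partial>M) +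
       (\<integral>\<^sup>+x. ennreal (norm (g x - h x) powr p) \<partial>M))"
    by (subst nn_integral_cmult; (subst nn_integral_add)?) auto
  finally show ?thesis .
qed

definition cutoff :: "real \<Rightarrow> 'a::euclidean_space \<Rightarrow> real" where
  "cutoff R x = max 0 (min 1 (R + 1 - norm x))"

lemma cutoff_bounds [simp]: "0 \<le> cutoff R x" "cutoff R x \<le> 1" "\<bar>cutoff R x\<bar> \<le> 1"
  by (auto simp: cutoff_def)

lemma cutoff_eq_1: "norm x \<le> R \<Longrightarrow> cutoff R x = 1"
  and cutoff_eq_0: "norm x \<ge> R + 1 \<Longrightarrow> cutoff R x = 0"
  by (auto simp: cutoff_def)

lemma continuous_on_cutoff [continuous_intros]: "continuous_on S (cutoff R)"
  unfolding cutoff_def[abs_def] by (intro continuous_intros)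

lemma closure_nonzero_subset_cball:
  assumes "\<And>x. norm x > R \<Longrightarrow> f x = 0"
  shows "closure {x::'a::euclidean_space. f x \<noteq> 0} \<subseteq> cball 0 R"
  using assms by (intro closure_minimal) (force simp: not_le[symmetric])+

lemma Cc_I:
  assumes "continuous_on UNIV f" "\<And>x. norm x > R \<Longrightarrow> f x = 0"
  shows "f \<in> Cc"
  using assms closure_nonzero_subset_cball[of R f]
  unfolding Cc_def by (auto intro: compact_closure[THEN iffD2] bounded_subset[OF bounded_cball]
      dest: order_trans[OF closure_subset])

lemma Cc_mult_cutoff: "continuous_on UNIV f \<Longrightarrow> (\<lambda>x. cutoff R x *\<^sub>R f x) \<in> Cc"
  by (rule Cc_I[of _ "R + 1"]) (auto intro!: continuous_intros simp: cutoff_eq_0)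

definition truncate :: "real \<Rightarrow> complex \<Rightarrow> complex" where
  "truncate M z = z /\<^sub>R max 1 (norm z / M)"

lemma norm_truncate_le: "M > 0 \<Longrightarrow> norm (truncate M z) \<le> M"
  by (auto simp: truncate_def max_def field_simps)

lemma truncate_id: "M > 0 \<Longrightarrow> norm z \<le> M \<Longrightarrow> truncate M z = z"
  by (auto simp: truncate_def max_def field_simps)

lemma continuous_on_truncate: "M > 0 \<Longrightarrow> continuous_on UNIV (truncate M)"
  unfolding truncate_def[abs_def]
  by (intro continuous_intros) (auto simp: max_def)

lemma nn_integral_powr_dominated:
  fixes f :: "'b \<Rightarrow> complex"
  assumes p: "p > 0" and [measurable]: "\<And>n. g n \<in> borel_measurable M" "f \<in> borel_measurable M"
    and w: "integrable M w"
    and bd: "\<And>n. AE x in M. norm (f x - g n x) powr p \<le> w x"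
    and lim: "AE x in M. (\<lambda>n. g n x) \<longlonglongrightarrow> f x"
  shows "(\<lambda>n. \<integral>\<^sup>+x. ennreal (norm (f x - g n x) powr p) \<partial>M) \<longlonglongrightarrow> 0"
proof -
  have "(\<lambda>n. \<integral>\<^sup>+x. ennreal (norm (0 - norm (f x - g n x) powr p)) \<partial>M) \<longlonglongrightarrow> 0"
  proof (rule nn_integral_dominated_convergence_norm)
    show "(\<integral>\<^sup>+x. ennreal (w x) \<partial>M) < \<infinity>"
      using w by (simp add: real_integrable_def less_top)
    show "AE x in M. norm (norm (f x - g n x) powr p) \<le> w x" for n
      using bd by simp
    show "AE x in M. (\<lambda>n. norm (f x - g n x) powr p) \<longlonglongrightarrow> 0"
      using lim
    proof eventually_elim
      case (elim x)
      have "(\<lambda>n. norm (f x - g n x)) \<longlonglongrightarrow> 0"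
        using tendsto_diff[OF tendsto_const[of "f x"] elim] by (simp add: tendsto_norm_zero_iff)
      from tendsto_powr'[OF this tendsto_const[of p]] show ?case using p by auto
    qed
  qed (use w in auto)
  then show ?thesis by simp
qed

lemma borel_measurable_Cc: "f \<in> Cc \<Longrightarrow> f \<in> borel_measurable borel"
  by (simp add: Cc_def borel_measurable_continuous_onI)

lemma Cc_bounded:
  assumes g: "g \<in> Cc"
  shows "\<exists>M>0. \<forall>x. norm (g x) \<le> M"
proof -
  let ?S = "closure {x. g x \<noteq> 0}"
  have "compact (g ` ?S)"
    using g by (auto simp: Cc_def intro!: compact_continuous_image intro: continuous_on_subset)
  then obtain C where C: "\<And>x. x \<in> ?S \<Longrightarrow> norm (g x) \<le> C" "C > 0"
    by (metis bounded_pos compact_imp_bounded imageI)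
  then have "norm (g x) \<le> C" for x
    using closure_subset[of "{x. g x \<noteq> 0}"] by (cases "g x = 0") (auto simp: subset_iff)
  then show ?thesis using C(2) by blast
qed

lemma Cc_support_bounded:
  fixes g :: "'a::euclidean_space \<Rightarrow> complex"
  assumes "g \<in> Cc"
  shows "\<exists>R>0. \<forall>x. norm x > R \<longrightarrow> g x = 0"
proof -
  have "bounded (closure {x. g x \<noteq> 0})" using assms by (auto simp: Cc_def compact_imp_bounded)
  then obtain R where R: "R > 0" "\<And>x. x \<in> closure {x. g x \<noteq> 0} \<Longrightarrow> norm x \<le> R" by (metis bounded_pos)
  then show ?thesis using closure_subset[of "{x. g x \<noteq> 0}"] by force
qed

lemma Cc_dense_Lp:
  assumes p: "p > 0" and f: "f \<in> Lp p" and e: "e > (0::real)"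
  shows "\<exists>g\<in>Cc. (\<integral>\<^sup>+x. ennreal (norm (f x - g x) powr p) \<partial>lborel) < ennreal e"
proof -
  have fm[measurable]: "f \<in> borel_measurable borel" and fi: "integrable lborel (\<lambda>x. norm (f x) powr p)"
    using f by (auto simp: Lp_def)
  have [measurable]: "truncate (real (Suc M)) \<in> borel_measurable borel" for M
    by (simp add: borel_measurable_continuous_onI continuous_on_truncate)
  have [measurable]: "cutoff R \<in> borel_measurable borel" for R :: real
    by (simp add: borel_measurable_continuous_onI continuous_on_cutoff)
  define h where "h k x = cutoff (real k) x *\<^sub>R truncate (real (Suc k)) (f x)" for k x
  have [measurable]: "h k \<in> borel_measurable borel" for k
    unfolding h_def[abs_def] by measurable
  have hf: "norm (f x - h k x) \<le> norm (f x)" for k x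
  proof -
    let ?c = "cutoff (real k) x / max 1 (norm (f x) / real (Suc k))"
    have "0 \<le> ?c" by (intro divide_nonneg_pos) (auto simp: less_max_iff_disj)
    moreover have "?c \<le> 1"
      by (subst divide_le_eq_1) (use cutoff_bounds(2)[of "real k" x] in \<open>auto simp: less_max_iff_disj max.coboundedI1\<close>)
    moreover have "f x - h k x = (1 - ?c) *\<^sub>R f x"
      by (simp add: h_def truncate_def scaleR_diff_left divide_inverse)
    ultimately show ?thesis by (simp add: mult_left_le_one_le)
  qed
  have "(\<lambda>k. \<integral>\<^sup>+x. ennreal (norm (f x - h k x) powr p) \<partial>lborel) \<longlonglongrightarrow> 0"
  proof (rule nn_integral_powr_dominated[OF p _ _ fi])
    show "AE x in lborel. norm (f x - h k x) powr p \<le> norm (f x) powr p" for k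
      using hf p by (intro AE_I2 powr_mono2) auto
    have "(\<lambda>k. h k x) \<longlonglongrightarrow> f x" for x
    proof (rule tendsto_eventually)
      obtain N :: nat where N: "real N \<ge> max (norm x) (norm (f x))" using real_arch_simple by blast
      show "\<forall>\<^sub>F k in sequentially. h k x = f x"
        using eventually_ge_at_top[of N]
      proof eventually_elim
        case (elim k)
        then have "real k \<ge> real N" by simp
        then show ?case using N by (simp add: h_def cutoff_eq_1 truncate_id)
      qed
    qed
    then show "AE x in lborel. (\<lambda>k. h k x) \<longlonglongrightarrow> f x" by simp
  qed auto
  moreover define e' where "e' = e / (2 powr p * 2)"
  moreover have e': "ennreal e' > 0"
    using e by (simp add: e'_def)
  ultimately obtain k where k: "(\<integral>\<^sup>+x. ennreal (norm (f x - h k x) powr p) \<partial>lborel) < ennreal e'"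
    by (metis (no_types, lifting) order_tendstoD(2) eventually_sequentially order_refl)
  have "f measurable_on UNIV"
    using fm by (intro lebesgue_measurable_imp_measurable_on) (auto intro: measurable_completion)
  then obtain N g where N: "negligible N" and g: "\<And>n. continuous_on UNIV (g n)"
    and gf: "\<And>x. x \<notin> N \<Longrightarrow> (\<lambda>n. g n x) \<longlonglongrightarrow> f x"
    by (auto simp: measurable_on_def)
  have [measurable]: "g n \<in> borel_measurable borel" for n
    using g by (simp add: borel_measurable_continuous_onI)
  have "AE x in lebesgue. x \<notin> N"
    using N by (simp add: AE_not_in negligible_iff_null_sets)
  then have aeN: "AE x in lborel. x \<notin> N" by (simp add: AE_completion_iff)
  define G where "G n x = cutoff (real k) x *\<^sub>R truncate (real (Suc k)) (g n x)" for n x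
  have GC: "G n \<in> Cc" for n
    unfolding G_def using g continuous_on_truncate[of "real (Suc k)"]
    by (intro Cc_mult_cutoff) (auto intro: continuous_on_compose2[of UNIV])
  let ?w = "\<lambda>x. (2 * real (Suc k)) powr p * indicator (cball (0::'a) (real k + 1)) x"
  have "(\<lambda>n. \<integral>\<^sup>+x. ennreal (norm (h k x - G n x) powr p) \<partial>lborel) \<longlonglongrightarrow> 0"
  proof (rule nn_integral_powr_dominated[OF p, where w = ?w])
    show "G n \<in> borel_measurable lborel" for n using borel_measurable_Cc[OF GC] by simp
    have fin: "emeasure lborel (cball (0::'a) (real k + 1)) < \<infinity>" by (rule emeasure_lborel_cball_finite)
    show "integrable lborel ?w"
      by (rule integrable_mult_right, rule integrable_real_indicator) (use fin in auto)
    have "norm (h k x - G n x) powr p \<le> ?w x" for n x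
    proof (cases "norm x \<le> real k + 1")
      case True
      have t: "norm (truncate (real (Suc k)) z) \<le> real (Suc k)" for z by (simp add: norm_truncate_le)
      have "norm (h k x - G n x) = cutoff (real k) x * norm (truncate (real (Suc k)) (f x) - truncate (real (Suc k)) (g n x))"
        by (simp add: h_def G_def scaleR_diff_right[symmetric] del: of_nat_Suc)
      also have "\<dots> \<le> 1 * (real (Suc k) + real (Suc k))"
        by (intro mult_mono order_trans[OF norm_triangle_ineq4] add_mono t) auto
      finally show ?thesis using True p by (auto intro!: powr_mono2)
    next
      case False
      then show ?thesis by (auto simp: h_def G_def cutoff_eq_0 p)
    qed
    then show "AE x in lborel. norm (h k x - G n x) powr p \<le> ?w x" for n by simp
    show "AE x in lborel. (\<lambda>n. G n x) \<longlonglongrightarrow> h k x"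
      using aeN
    proof eventually_elim
      case (elim x)
      have "isCont (truncate (real (Suc k))) (f x)"
        using continuous_on_truncate[of "real (Suc k)"] by (simp add: continuous_on_eq_continuous_at)
      from isCont_tendsto_compose[OF this gf[OF elim]] show ?case
        unfolding h_def G_def by (intro tendsto_intros)
    qed
  qed auto
  then obtain n where n: "(\<integral>\<^sup>+x. ennreal (norm (h k x - G n x) powr p) \<partial>lborel) < ennreal e'"
    using e' by (metis (no_types, lifting) order_tendstoD(2) eventually_sequentially order_refl)
  have [measurable]: "G n \<in> borel_measurable borel" using borel_measurable_Cc[OF GC] by simp
  have "(\<integral>\<^sup>+x. ennreal (norm (f x - G n x) powr p) \<partial>lborel) \<le> ennreal (2 powr p) *
     ((\<integral>\<^sup>+x. ennreal (norm (f x - h k x) powr p) \<partial>lborel) + (\<integral>\<^sup>+x. ennreal (norm (h k x - G n x) powr p) \<partial>lborel))"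
    using p by (intro nn_integral_powr_triangle) auto
  also have "\<dots> < ennreal (2 powr p) * (ennreal e' + ennreal e')"
    by (intro ennreal_mult_strict_left_mono add_strict_mono k n) auto
  also have "\<dots> = ennreal e"
    using e by (simp add: e'_def flip: ennreal_plus ennreal_mult)
  finally show ?thesis using GC by blast
qed

section \<open>Gaussian mollification\<close>

lemma nn_integral_lborel_affine:
  fixes f :: "'a::euclidean_space \<Rightarrow> ennreal" and t :: 'a
  assumes [measurable]: "f \<in> borel_measurable borel" and c: "c \<noteq> 0"
  shows "(\<integral>\<^sup>+x. f x \<partial>lborel) = ennreal (\<bar>c\<bar> ^ DIM('a)) * (\<integral>\<^sup>+x. f (t + c *\<^sub>R x) \<partial>lborel)"
  by (subst lborel_affine[OF c, of t]) (simp add: nn_integral_density nn_integral_distr nn_integral_cmult)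

lemma integrable_lborel_affine:
  fixes f :: "'a::euclidean_space \<Rightarrow> 'b::{banach, second_countable_topology}" and t :: 'a
  assumes f: "integrable lborel f" and c: "c \<noteq> 0"
  shows "integrable lborel (\<lambda>x. f (t + c *\<^sub>R x))"
proof -
  have [measurable]: "f \<in> borel_measurable borel" using f by auto
  show ?thesis
    using f nn_integral_lborel_affine[of "\<lambda>x. ennreal (norm (f x))" c t] c unfolding integrable_iff_bounded
    by (auto simp: ennreal_mult_less_top)
qed

lemma integral_lborel_affine:
  fixes f :: "'a::euclidean_space \<Rightarrow> 'b::{banach, second_countable_topology}" and t :: 'a
  assumes f: "integrable lborel f" and c: "c \<noteq> 0"
  shows "(\<integral>x. f x \<partial>lborel) = \<bar>c\<bar> ^ DIM('a) *\<^sub>R (\<integral>x. f (t + c *\<^sub>R x) \<partial>lborel)"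
proof -
  have [measurable]: "f \<in> borel_measurable borel" using f by auto
  show ?thesis
    using integrable_lborel_affine[OF assms, of t]
    by (subst lborel_affine[OF c, of t]) (simp add: integral_density integral_distr)
qed

lemma
  fixes f :: "'a::euclidean_space \<Rightarrow> real \<Rightarrow> 'b::{real_normed_field, banach, second_countable_topology}"
  assumes f: "\<And>b. b \<in> Basis \<Longrightarrow> integrable lborel (f b)"
  shows integrable_lborel_prod: "integrable lborel (\<lambda>x::'a. \<Prod>b\<in>Basis. f b (x \<bullet> b))"
    and integral_lborel_prod: "(\<integral>x. (\<Prod>b\<in>Basis. f b (x \<bullet> b)) \<partial>(lborel :: 'a measure)) = (\<Prod>b\<in>Basis. \<integral>x. f b x \<partial>lborel)"
proof -
  interpret P: finite_product_sigma_finite "\<lambda>_::'a. lborel :: real measure" Basis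
    by standard auto
  have [measurable]: "b \<in> Basis \<Longrightarrow> f b \<in> borel_measurable borel" for b using f[of b] by auto
  have e: "(\<Prod>b\<in>Basis. f b ((\<Sum>b\<in>Basis. x b *\<^sub>R b) \<bullet> b)) = (\<Prod>b\<in>Basis. f b (x b))" for x
    by (intro prod.cong) auto
  show "integrable lborel (\<lambda>x::'a. \<Prod>b\<in>Basis. f b (x \<bullet> b))"
    by (subst lborel_eq, subst integrable_distr_eq) (auto simp: e intro!: P.product_integrable_prod f)
  show "(\<integral>x. (\<Prod>b\<in>Basis. f b (x \<bullet> b)) \<partial>(lborel :: 'a measure)) = (\<Prod>b\<in>Basis. \<integral>x. f b x \<partial>lborel)"
    by (subst lborel_eq, subst integral_distr) (auto simp: e intro!: P.product_integral_prod f)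
qed

definition gauss :: "'a::euclidean_space \<Rightarrow> real" where
  "gauss x = (\<Prod>b\<in>Basis. std_normal_density (x \<bullet> b))"

lemma gauss_nonneg: "0 \<le> gauss x"
  by (auto simp: gauss_def intro!: prod_nonneg)

lemma gauss_eq: "gauss (x::'a::euclidean_space) = exp (- (norm x)\<^sup>2 / 2) / sqrt (2 * pi) ^ DIM('a)"
proof -
  have "gauss x = (\<Prod>b\<in>(Basis::'a set). exp (- (x \<bullet> b)\<^sup>2 / 2)) / sqrt (2 * pi) ^ DIM('a)"
    by (simp add: gauss_def std_normal_density_def prod_dividef prod.distrib)
  also have "(\<Prod>b\<in>(Basis::'a set). exp (- (x \<bullet> b)\<^sup>2 / 2)) = exp (- (norm x)\<^sup>2 / 2)"
    by (subst exp_sum[symmetric])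
       (auto simp: norm_eq_sqrt_inner euclidean_inner[of x x] power2_eq_square sum_negf sum_divide_distrib sum_nonneg)
  finally show ?thesis .
qed

lemma integrable_gauss: "integrable lborel (gauss :: 'a::euclidean_space \<Rightarrow> real)"
  unfolding gauss_def[abs_def] by (intro integrable_lborel_prod) simp

lemma integral_gauss: "(\<integral>x. gauss x \<partial>(lborel :: 'a::euclidean_space measure)) = 1"
  unfolding gauss_def by (subst integral_lborel_prod) simp_all

lemma borel_measurable_gauss [measurable]: "gauss \<in> borel_measurable borel"
  using integrable_gauss by auto

lemma nn_integral_gauss: "(\<integral>\<^sup>+x. gauss x \<partial>(lborel :: 'a::euclidean_space measure)) = 1"
  by (subst nn_integral_eq_integral) (auto simp: integrable_gauss integral_gauss gauss_nonneg)

lemma cis_inner_eq: "cis (s \<bullet> y) = (\<Prod>b\<in>Basis. iexp ((s \<bullet> b) * (y \<bullet> b)))" for s y :: "'a::euclidean_space"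
  by (subst exp_sum[symmetric]) (auto simp: cis_conv_exp euclidean_inner[of s y] sum_distrib_left)

lemma integral_cis_gauss:
  fixes s :: "'a::euclidean_space"
  shows "(\<integral>y. cis (s \<bullet> y) * gauss y \<partial>lborel) = exp (- (norm s)\<^sup>2 / 2)"
proof -
  have 1: "(\<integral>x. iexp (t * x) * complex_of_real (std_normal_density x) \<partial>lborel) = exp (- t\<^sup>2 / 2)" for t
  proof -
    have "char std_normal_distribution t = (\<integral>x. std_normal_density x *\<^sub>R iexp (t * x) \<partial>lborel)"
      unfolding char_def by (subst integral_density) (auto simp: normal_density_nonneg)
    also have "\<dots> = (\<integral>x. iexp (t * x) * complex_of_real (std_normal_density x) \<partial>lborel)"
      by (simp add: scaleR_conv_of_real mult.commute)
    finally show ?thesis by (simp add: char_std_normal_distribution)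
  qed
  have i: "integrable lborel (\<lambda>x. iexp (t * x) * complex_of_real (std_normal_density x))" for t
    by (rule Bochner_Integration.integrable_bound[of _ "std_normal_density"])
       (auto simp: norm_mult normal_density_nonneg)
  have "(\<integral>y. cis (s \<bullet> y) * gauss y \<partial>lborel) =
      (\<integral>y. (\<Prod>b\<in>Basis. iexp ((s \<bullet> b) * (y \<bullet> b)) * complex_of_real (std_normal_density (y \<bullet> b))) \<partial>lborel)"
    by (simp add: cis_inner_eq gauss_def prod.distrib)
  also have "\<dots> = (\<Prod>b\<in>Basis. complex_of_real (exp (- (s \<bullet> b)\<^sup>2 / 2)))"
    by (subst integral_lborel_prod[OF i]) (intro prod.cong refl 1)
  also have "\<dots> = exp (- (norm s)\<^sup>2 / 2)"
    unfolding of_real_prod[symmetric]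
    by (subst exp_sum[symmetric])
       (auto simp: norm_eq_sqrt_inner euclidean_inner[of s s] power2_eq_square sum_negf sum_divide_distrib sum_nonneg)
  finally show ?thesis .
qed

definition mollify :: "real \<Rightarrow> ('a::euclidean_space \<Rightarrow> complex) \<Rightarrow> 'a \<Rightarrow> complex" where
  "mollify t f x = (\<integral>y. f (x - t *\<^sub>R y) * gauss y \<partial>lborel)"

lemma borel_measurable_mollify [measurable]:
  assumes [measurable]: "f \<in> borel_measurable borel"
  shows "mollify t f \<in> borel_measurable borel"
  unfolding mollify_def[abs_def] by measurable

lemma nn_integral_translate:
  fixes f :: "'a::euclidean_space \<Rightarrow> ennreal"
  assumes "f \<in> borel_measurable borel"
  shows "(\<integral>\<^sup>+x. f (x - a) \<partial>lborel) = (\<integral>\<^sup>+x. f x \<partial>lborel)"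
  using nn_integral_lborel_affine[OF assms, of 1 "- a"] by simp

lemma L1_translation_continuous:
  fixes f :: "'a::euclidean_space \<Rightarrow> complex"
  assumes f: "integrable lborel f" and a: "a \<longlonglongrightarrow> 0"
  shows "(\<lambda>n. \<integral>\<^sup>+x. ennreal (norm (f (x - a n) - f x)) \<partial>lborel) \<longlonglongrightarrow> 0"
proof -
  have [measurable]: "f \<in> borel_measurable borel" using f by auto
  have fL: "f \<in> Lp 1" using f by (auto simp: Lp_def)
  show ?thesis
  proof (rule order_tendstoI)
    fix e :: ennreal assume "e > 0"
    then obtain e1 where e1: "0 < e1" "e1 < e" using dense by blast
    then obtain d where d: "e1 = ennreal d" "d > 0" by (cases e1) auto
    obtain g where g: "g \<in> Cc" and fg: "(\<integral>\<^sup>+x. ennreal (norm (f x - g x) powr 1) \<partial>lborel) < ennreal (d / 3)"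
      using Cc_dense_Lp[OF _ fL, of "d / 3"] d by auto
    have [measurable]: "g \<in> borel_measurable borel" using g by (rule borel_measurable_Cc)
    let ?I = "\<integral>\<^sup>+x. ennreal (norm (f x - g x)) \<partial>lborel"
    have I: "?I < ennreal (d / 3)" using fg by simp
    obtain R where R: "R > 0" and supp: "\<And>x. norm x > R \<Longrightarrow> g x = 0"
      using Cc_support_bounded[OF g] by blast
    obtain N where N: "\<And>n. n \<ge> N \<Longrightarrow> norm (a n) < 1"
      using LIMSEQ_D[OF a, of 1] by auto
    obtain M where M: "\<And>x. norm (g x) \<le> M"
      using Cc_bounded[OF g] by blast
    have gc: "isCont g x" for x using g by (auto simp: Cc_def continuous_on_eq_continuous_at)
    have "(\<lambda>n. \<integral>\<^sup>+x. ennreal (norm (g x - g (x - a (n + N))) powr 1) \<partial>lborel) \<longlonglongrightarrow> 0"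
    proof (rule nn_integral_powr_dominated)
      show "integrable lborel (\<lambda>x. (2 * M) * indicator (cball (0::'a) (R + 1)) x)"
        using emeasure_lborel_cball_finite[of "0::'a" "R + 1"]
        by (intro integrable_mult_right integrable_real_indicator) auto
      show "AE x in lborel. norm (g x - g (x - a (n + N))) powr 1 \<le> (2 * M) * indicator (cball 0 (R + 1)) x" for n
      proof (rule AE_I2)
        fix x
        show "norm (g x - g (x - a (n + N))) powr 1 \<le> (2 * M) * indicator (cball 0 (R + 1)) x"
        proof (cases "norm x \<le> R + 1")
          case True
          then show ?thesis using norm_triangle_ineq4[of "g x" "g (x - a (n + N))"] M[of x] M[of "x - a (n + N)"]
            by simp
        next
          case False
          then have "norm (x - a (n + N)) > R"
            using norm_triangle_ineq[of "x - a (n + N)" "a (n + N)"] N[of "n + N"] by simp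
          then show ?thesis using False by (simp add: supp)
        qed
      qed
      show "AE x in lborel. (\<lambda>n. g (x - a (n + N))) \<longlonglongrightarrow> g x"
      proof (rule AE_I2)
        fix x
        have "(\<lambda>n. x - a (n + N)) \<longlonglongrightarrow> x - 0"
          by (intro tendsto_intros LIMSEQ_ignore_initial_segment a)
        then show "(\<lambda>n. g (x - a (n + N))) \<longlonglongrightarrow> g x"
          using isCont_tendsto_compose[OF gc[of x]] by simp
      qed
    qed auto
    then have "(\<lambda>n. \<integral>\<^sup>+x. ennreal (norm (g (x - a (n + N)) - g x)) \<partial>lborel) \<longlonglongrightarrow> 0"
      by (simp add: norm_minus_commute)
    then have "(\<lambda>n. \<integral>\<^sup>+x. ennreal (norm (g (x - a n) - g x)) \<partial>lborel) \<longlonglongrightarrow> 0"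
      by (rule LIMSEQ_offset)
    then have "\<forall>\<^sub>F n in sequentially. (\<integral>\<^sup>+x. ennreal (norm (g (x - a n) - g x)) \<partial>lborel) < ennreal (d / 3)"
      by (rule order_tendstoD) (use d in simp)
    then show "\<forall>\<^sub>F n in sequentially. (\<integral>\<^sup>+x. ennreal (norm (f (x - a n) - f x)) \<partial>lborel) < e"
    proof eventually_elim
      case (elim n)
      have "(\<integral>\<^sup>+x. ennreal (norm (f (x - a n) - f x)) \<partial>lborel) \<le>
        (\<integral>\<^sup>+x. ennreal (norm (f (x - a n) - g (x - a n))) + (ennreal (norm (g (x - a n) - g x)) + ennreal (norm (f x - g x))) \<partial>lborel)"
      proof (rule nn_integral_mono)
        fix x
        have "norm (f (x - a n) - f x) \<le> norm (f (x - a n) - g (x - a n)) + (norm (g (x - a n) - g x) + norm (f x - g x))"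
          by norm
        then show "ennreal (norm (f (x - a n) - f x)) \<le>
          ennreal (norm (f (x - a n) - g (x - a n))) + (ennreal (norm (g (x - a n) - g x)) + ennreal (norm (f x - g x)))"
          by (simp flip: ennreal_plus)
      qed
      also have "\<dots> = (\<integral>\<^sup>+x. ennreal (norm (f (x - a n) - g (x - a n))) \<partial>lborel) +
          ((\<integral>\<^sup>+x. ennreal (norm (g (x - a n) - g x)) \<partial>lborel) + ?I)"
        by (simp add: nn_integral_add)
      also have "(\<integral>\<^sup>+x. ennreal (norm (f (x - a n) - g (x - a n))) \<partial>lborel) = ?I"
        by (subst nn_integral_translate[of "\<lambda>x. ennreal (norm (f x - g x))"]) auto
      also have "?I + ((\<integral>\<^sup>+x. ennreal (norm (g (x - a n) - g x)) \<partial>lborel) + ?I) < ennreal (d / 3) + (ennreal (d / 3) + ennreal (d / 3))"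
        by (intro add_strict_mono I elim)
      also have "\<dots> = ennreal d" using d by (simp flip: ennreal_plus)
      finally show ?case using e1 d by simp
    qed
  qed simp
qed

lemma integrable_mollify_integrand:
  fixes f :: "'a::euclidean_space \<Rightarrow> complex"
  assumes f: "integrable lborel f" and t: "t > 0"
  shows "integrable lborel (\<lambda>y. f (x - t *\<^sub>R y) * gauss y)"
proof (rule Bochner_Integration.integrable_bound)
  let ?C = "1 / sqrt (2 * pi) ^ DIM('a)"
  show "integrable lborel (\<lambda>y. ?C *\<^sub>R f (x - t *\<^sub>R y))"
    using integrable_lborel_affine[OF f, of "- t" x] t by (intro integrable_scaleR_right) simp
  have [measurable]: "f \<in> borel_measurable borel" using f by auto
  show "(\<lambda>y. f (x - t *\<^sub>R y) * gauss y) \<in> borel_measurable lborel" by measurable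
  have "gauss y \<le> ?C" for y :: 'a
    by (auto simp: gauss_eq intro!: divide_right_mono)
  then have "norm (f z) * gauss y \<le> norm (f z) * ?C" for y z :: 'a
    by (rule mult_left_mono) simp
  then show "AE y in lborel. norm (f (x - t *\<^sub>R y) * gauss y) \<le> norm (?C *\<^sub>R f (x - t *\<^sub>R y))"
    by (intro AE_I2) (simp add: norm_mult gauss_nonneg)
qed

lemma mollify_tendsto_L1:
  fixes f :: "'a::euclidean_space \<Rightarrow> complex"
  assumes f: "integrable lborel f" and t: "t \<longlonglongrightarrow> 0" and tp: "\<And>n. t n > 0"
  shows "(\<lambda>n. \<integral>\<^sup>+x. ennreal (norm (mollify (t n) f x - f x)) \<partial>lborel) \<longlonglongrightarrow> 0"
proof -
  have [measurable]: "f \<in> borel_measurable borel" using f by auto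
  define T where "T n y = (\<integral>\<^sup>+x. ennreal (norm (f (x - t n *\<^sub>R y) - f x)) \<partial>lborel)" for n y
  have [measurable]: "T n \<in> borel_measurable borel" for n
    unfolding T_def[abs_def] by measurable
  let ?F = "\<integral>\<^sup>+x. ennreal (norm (f x)) \<partial>lborel"
  have Tb: "T n y \<le> 2 * ?F" for n y
  proof -
    have "T n y \<le> (\<integral>\<^sup>+x. ennreal (norm (f (x - t n *\<^sub>R y))) + ennreal (norm (f x)) \<partial>lborel)"
      unfolding T_def by (intro nn_integral_mono) (auto simp: norm_triangle_ineq4 simp flip: ennreal_plus)
    also have "\<dots> = 2 * ?F"
      by (subst nn_integral_add, simp, simp, subst nn_integral_translate[of "\<lambda>x. ennreal (norm (f x))"])
        (auto simp: mult_2)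
    finally show ?thesis .
  qed
  have le: "(\<integral>\<^sup>+x. ennreal (norm (mollify (t n) f x - f x)) \<partial>lborel) \<le> (\<integral>\<^sup>+y. T n y * gauss y \<partial>lborel)" for n
  proof -
    have "ennreal (norm (mollify (t n) f x - f x)) \<le> (\<integral>\<^sup>+y. ennreal (norm (f (x - t n *\<^sub>R y) - f x)) * gauss y \<partial>lborel)" for x
    proof -
      have ig: "integrable lborel (\<lambda>y::'a. f x * complex_of_real (gauss y))"
        using integrable_gauss by (intro integrable_mult_right integrable_of_real)
      have "mollify (t n) f x - f x = (\<integral>y. f (x - t n *\<^sub>R y) * gauss y \<partial>lborel) - (\<integral>y. f x * gauss y \<partial>(lborel :: 'a measure))"
        by (simp add: mollify_def integral_gauss)
      also have "\<dots> = (\<integral>y. (f (x - t n *\<^sub>R y) - f x) * gauss y \<partial>lborel)"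
        by (subst Bochner_Integration.integral_diff[symmetric, OF integrable_mollify_integrand[OF f tp] ig])
           (simp add: algebra_simps)
      also have "ennreal (norm \<dots>) \<le> (\<integral>\<^sup>+y. ennreal (norm ((f (x - t n *\<^sub>R y) - f x) * gauss y)) \<partial>lborel)"
        by (rule integral_norm_bound_ennreal)
          (use Bochner_Integration.integrable_diff[OF integrable_mollify_integrand[OF f tp] ig] in \<open>simp add: algebra_simps\<close>)
      finally show ?thesis by (simp add: norm_mult gauss_nonneg ennreal_mult)
    qed
    then have "(\<integral>\<^sup>+x. ennreal (norm (mollify (t n) f x - f x)) \<partial>lborel) \<le>
       (\<integral>\<^sup>+x. (\<integral>\<^sup>+y. ennreal (norm (f (x - t n *\<^sub>R y) - f x)) * gauss y \<partial>lborel) \<partial>lborel)"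
      by (intro nn_integral_mono)
    also have "\<dots> = (\<integral>\<^sup>+y. (\<integral>\<^sup>+x. ennreal (norm (f (x - t n *\<^sub>R y) - f x)) * gauss y \<partial>lborel) \<partial>lborel)"
      by (rule lborel_pair.Fubini'[symmetric]) measurable
    also have "\<dots> = (\<integral>\<^sup>+y. T n y * gauss y \<partial>lborel)"
      unfolding T_def by (subst nn_integral_multc) auto
    finally show ?thesis .
  qed
  have Ffin: "?F < \<infinity>" using f by (auto simp: integrable_iff_bounded)
  have "(\<lambda>n. \<integral>\<^sup>+y. T n y * gauss y \<partial>lborel) \<longlonglongrightarrow> (\<integral>\<^sup>+y. 0 \<partial>(lborel :: 'a measure))"
  proof (rule nn_integral_dominated_convergence)
    show "AE y in lborel. T n y * ennreal (gauss y) \<le> 2 * ?F * ennreal (gauss y)" for n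
      by (intro AE_I2 mult_right_mono Tb) auto
    show "(\<integral>\<^sup>+y. 2 * ?F * ennreal (gauss y) \<partial>(lborel :: 'a measure)) < \<infinity>"
      using Ffin by (subst nn_integral_cmult) (auto simp: nn_integral_gauss ennreal_mult_less_top)
    show "AE y in lborel. (\<lambda>n. T n y * ennreal (gauss y)) \<longlonglongrightarrow> 0"
    proof (rule AE_I2)
      fix y :: 'a
      have "(\<lambda>n. t n *\<^sub>R y) \<longlonglongrightarrow> 0 *\<^sub>R y" by (intro tendsto_intros t)
      then have "(\<lambda>n. T n y) \<longlonglongrightarrow> 0"
        unfolding T_def by (intro L1_translation_continuous f) simp
      then have "(\<lambda>n. T n y * ennreal (gauss y)) \<longlonglongrightarrow> 0 * ennreal (gauss y)"
        by (intro tendsto_mult_ennreal tendsto_const) auto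
      then show "(\<lambda>n. T n y * ennreal (gauss y)) \<longlonglongrightarrow> 0" by simp
    qed
  qed auto
  then have "(\<lambda>n. \<integral>\<^sup>+y. T n y * gauss y \<partial>lborel) \<longlonglongrightarrow> 0" by simp
  then show ?thesis
    by (rule tendsto_sandwich[OF _ _ tendsto_const, rotated 2]) (use le in auto)
qed

section \<open>Fourier inversion\<close>

lemma borel_measurable_cis [measurable]: "cis \<in> borel_measurable borel"
  by (intro borel_measurable_continuous_onI continuous_intros)

lemma borel_measurable_fourier [measurable]:
  assumes [measurable]: "f \<in> borel_measurable borel"
  shows "fourier f \<in> borel_measurable borel"
  unfolding fourier_def[abs_def] by measurable

lemma norm_fourier_le: "norm (fourier f \<xi>) \<le> (LINT x|lborel. norm (f x))"
  unfolding fourier_def by (rule order_trans[OF integral_norm_bound]) (simp add: norm_mult)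

lemma integrable_pair_bounded:
  fixes f :: "'a::euclidean_space \<times> 'b::euclidean_space \<Rightarrow> complex" and c :: "'a \<Rightarrow> real"
  assumes "f \<in> borel_measurable (lborel \<Otimes>\<^sub>M lborel)" "\<And>y. integrable lborel (\<lambda>x. f (y, x))"
    "\<And>y. (LINT x|lborel. norm (f (y, x))) = c y" "integrable lborel c"
  shows "integrable (lborel \<Otimes>\<^sub>M lborel) f"
proof -
  show ?thesis using assms by (intro lborel_pair.Fubini_integrable) auto
qed

lemma
  fixes f :: "'a::euclidean_space \<Rightarrow> complex"
  assumes f: "integrable lborel f"
  shows integrable_mollify: "integrable lborel (mollify t f)"
    and fourier_mollify: "fourier (mollify t f) \<xi> = fourier f \<xi> * exp (- (norm ((2 * pi * t) *\<^sub>R \<xi>))\<^sup>2 / 2)"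
proof -
  have [measurable]: "f \<in> borel_measurable borel" using f by auto
  define F where "F \<xi> = (\<lambda>(y, x). cis (- 2 * pi * (x \<bullet> \<xi>)) * (f (x - t *\<^sub>R y) * gauss y))" for \<xi> :: 'a
  have tr: "integrable lborel (\<lambda>x. f (x - z))" for z
    using integrable_lborel_affine[OF f, of 1 "- z"] by simp
  have inf: "integrable lborel (\<lambda>x. cis (- 2 * pi * (x \<bullet> \<xi>)) * g x)" if "integrable lborel g" for g \<xi>
  proof (rule Bochner_Integration.integrable_bound[OF that])
    have [measurable]: "g \<in> borel_measurable borel" using that by auto
    show "(\<lambda>x. cis (- 2 * pi * (x \<bullet> \<xi>)) * g x) \<in> borel_measurable lborel" by measurable
  qed (simp add: norm_mult)
  have Fi: "integrable (lborel \<Otimes>\<^sub>M lborel) (F \<xi>)" for \<xi>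
  proof (rule integrable_pair_bounded)
    show "F \<xi> \<in> borel_measurable (lborel \<Otimes>\<^sub>M lborel)" unfolding F_def by measurable
    show "integrable lborel (\<lambda>x. F \<xi> (y, x))" for y
      unfolding F_def prod.case by (intro inf integrable_mult_left tr)
    show "(LINT x|lborel. norm (F \<xi> (y, x))) = (LINT x|lborel. norm (f x)) * gauss y" for y
      using integral_lborel_affine[OF integrable_norm[OF f], of 1 "- (t *\<^sub>R y)"]
      by (simp add: F_def norm_mult gauss_nonneg)
    show "integrable lborel (\<lambda>y::'a. (LINT x|lborel. norm (f x)) * gauss y)"
      by (intro integrable_mult_right integrable_gauss)
  qed
  have inner: "(LINT y|lborel. F \<xi> (y, x)) = cis (- 2 * pi * (x \<bullet> \<xi>)) * mollify t f x" for \<xi> x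
    by (simp add: F_def mollify_def)
  have "integrable lborel (\<lambda>x. LINT y|lborel. F 0 (y, x))"
    by (rule lborel_pair.integrable_snd) (simp add: Fi)
  then show "integrable lborel (mollify t f)" by (simp add: inner)
  have "fourier (mollify t f) \<xi> = (LINT x|lborel. LINT y|lborel. F \<xi> (y, x))"
    by (simp add: fourier_def inner)
  also have "\<dots> = (LINT y|lborel. LINT x|lborel. F \<xi> (y, x))"
    using Fi[of \<xi>] by (intro lborel_pair.Fubini_integral) simp
  also have "\<dots> = (LINT y|lborel. fourier f \<xi> * (cis ((- (2 * pi * t) *\<^sub>R \<xi>) \<bullet> y) * gauss y))"
  proof (rule Bochner_Integration.integral_cong[OF refl])
    fix y
    have "(LINT x|lborel. F \<xi> (y, x)) = (LINT x|lborel. cis (- 2 * pi * (x \<bullet> \<xi>)) * f (x - t *\<^sub>R y)) * gauss y"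
      by (simp add: F_def mult.assoc[symmetric])
    also have "(LINT x|lborel. cis (- 2 * pi * (x \<bullet> \<xi>)) * f (x - t *\<^sub>R y)) =
        (LINT x|lborel. cis (- 2 * pi * ((t *\<^sub>R y + x) \<bullet> \<xi>)) * f x)"
      using integral_lborel_affine[OF inf[OF tr[of "t *\<^sub>R y"]], of 1 \<xi> "t *\<^sub>R y"] by simp
    also have "\<dots> = (LINT x|lborel. cis ((- (2 * pi * t) *\<^sub>R \<xi>) \<bullet> y) * (cis (- 2 * pi * (x \<bullet> \<xi>)) * f x))"
    proof (rule Bochner_Integration.integral_cong[OF refl])
      fix x
      have "- 2 * pi * ((t *\<^sub>R y + x) \<bullet> \<xi>) = (- (2 * pi * t) *\<^sub>R \<xi>) \<bullet> y + - 2 * pi * (x \<bullet> \<xi>)"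
        by (simp add: inner_add_left inner_commute[of y] distrib_left)
      then show "cis (- 2 * pi * ((t *\<^sub>R y + x) \<bullet> \<xi>)) * f x =
          cis ((- (2 * pi * t) *\<^sub>R \<xi>) \<bullet> y) * (cis (- 2 * pi * (x \<bullet> \<xi>)) * f x)"
        by (simp only: cis_mult[symmetric] mult.assoc)
    qed
    also have "\<dots> = cis ((- (2 * pi * t) *\<^sub>R \<xi>) \<bullet> y) * fourier f \<xi>"
      by (simp add: fourier_def)
    finally show "(LINT x|lborel. F \<xi> (y, x)) = fourier f \<xi> * (cis ((- (2 * pi * t) *\<^sub>R \<xi>) \<bullet> y) * gauss y)"
      by simp
  qed
  also have "\<dots> = fourier f \<xi> * exp (- (norm (- (2 * pi * t) *\<^sub>R \<xi>))\<^sup>2 / 2)"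
    unfolding integral_mult_right_zero integral_cis_gauss ..
  finally show "fourier (mollify t f) \<xi> = fourier f \<xi> * exp (- (norm ((2 * pi * t) *\<^sub>R \<xi>))\<^sup>2 / 2)"
    by simp
qed

lemma integrable_gaussian_weight:
  assumes "c > 0"
  shows "integrable lborel (\<lambda>\<xi>::'a::euclidean_space. exp (- (norm (c *\<^sub>R \<xi>))\<^sup>2 / 2))"
proof -
  have "integrable lborel (\<lambda>\<xi>::'a. sqrt (2 * pi) ^ DIM('a) * gauss (0 + c *\<^sub>R \<xi>))"
    using assms by (intro integrable_mult_right integrable_lborel_affine integrable_gauss) auto
  then show ?thesis by (simp add: gauss_eq)
qed

lemma mollify_in_fourier_core:
  fixes f :: "'a::euclidean_space \<Rightarrow> complex"
  assumes f: "integrable lborel f" and t: "t > 0"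
  shows "mollify t f \<in> fourier_core"
proof -
  have [measurable]: "f \<in> borel_measurable borel" using f by auto
  let ?E = "\<lambda>\<xi>::'a. exp (- (norm ((2 * pi * t) *\<^sub>R \<xi>))\<^sup>2 / 2)"
  have "integrable lborel (fourier (mollify t f))"
  proof (rule Bochner_Integration.integrable_bound)
    show "integrable lborel (\<lambda>\<xi>. (LINT x|lborel. norm (f x)) * ?E \<xi>)"
      using t by (intro integrable_mult_right integrable_gaussian_weight) simp
    show "fourier (mollify t f) \<in> borel_measurable lborel" by simp
    show "AE \<xi> in lborel. norm (fourier (mollify t f) \<xi>) \<le> norm ((LINT x|lborel. norm (f x)) * ?E \<xi>)"
      unfolding fourier_mollify[OF f]
      by (intro AE_I2) (auto simp: norm_mult abs_mult intro!: mult_right_mono norm_fourier_le)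
  qed
  then show ?thesis using integrable_mollify[OF f] by (simp add: fourier_core_def)
qed

lemma mollify_eq_inv_fourier:
  fixes f :: "'a::euclidean_space \<Rightarrow> complex"
  assumes f: "integrable lborel f" and t: "t > 0"
  shows "mollify t f x =
    inv_fourier (\<lambda>\<xi>. exp (- (norm ((2 * pi * t) *\<^sub>R \<xi>))\<^sup>2 / 2) * fourier f \<xi>) x"
proof -
  have [measurable]: "f \<in> borel_measurable borel" using f by auto
  define d where "d = DIM('a)"
  define c where "c = 2 * pi * t"
  have c: "c > 0" using t by (simp add: c_def)
  define E where "E \<xi> = exp (- (norm (c *\<^sub>R \<xi>))\<^sup>2 / 2)" for \<xi> :: 'a
  have Ei: "integrable lborel E" unfolding E_def[abs_def] by (rule integrable_gaussian_weight[OF c])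
  have [measurable]: "E \<in> borel_measurable borel" using Ei by auto
  have E0: "E \<xi> \<ge> 0" for \<xi> by (simp add: E_def)
  define F where "F = (\<lambda>(z, \<xi>). f z * (cis (2 * pi * ((x - z) \<bullet> \<xi>)) * E \<xi>))"
  have Ec: "integrable lborel (\<lambda>\<xi>. cis (2 * pi * (z \<bullet> \<xi>)) * E \<xi>)" for z
    by (rule Bochner_Integration.integrable_bound[OF Ei]) (auto simp: norm_mult)
  have Fi: "integrable (lborel \<Otimes>\<^sub>M lborel) F"
  proof (rule integrable_pair_bounded)
    show "F \<in> borel_measurable (lborel \<Otimes>\<^sub>M lborel)" unfolding F_def by measurable
    show "integrable lborel (\<lambda>\<xi>. F (z, \<xi>))" for z
      unfolding F_def prod.case by (intro integrable_mult_right Ec)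
    show "(LINT \<xi>|lborel. norm (F (z, \<xi>))) = norm (f z) * (LINT \<xi>|lborel. E \<xi>)" for z
      by (simp add: F_def norm_mult E0)
    show "integrable lborel (\<lambda>z. norm (f z) * (LINT \<xi>|lborel. E \<xi>))"
      using f by simp
  qed
  have in1: "(LINT z|lborel. F (z, \<xi>)) = cis (2 * pi * (x \<bullet> \<xi>)) * (E \<xi> * fourier f \<xi>)" for \<xi>
  proof -
    have "(LINT z|lborel. F (z, \<xi>)) = (LINT z|lborel. (cis (2 * pi * (x \<bullet> \<xi>)) * E \<xi>) * (cis (- 2 * pi * (z \<bullet> \<xi>)) * f z))"
    proof (rule Bochner_Integration.integral_cong[OF refl])
      fix z
      have "cis (2 * pi * ((x - z) \<bullet> \<xi>)) = cis (2 * pi * (x \<bullet> \<xi>)) * cis (- 2 * pi * (z \<bullet> \<xi>))"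
        by (simp add: cis_mult inner_diff_left algebra_simps)
      then show "F (z, \<xi>) = (cis (2 * pi * (x \<bullet> \<xi>)) * E \<xi>) * (cis (- 2 * pi * (z \<bullet> \<xi>)) * f z)"
        by (simp add: F_def)
    qed
    also have "\<dots> = cis (2 * pi * (x \<bullet> \<xi>)) * (E \<xi> * fourier f \<xi>)"
      unfolding integral_mult_right_zero fourier_def by simp
    finally show ?thesis .
  qed
  have in2: "(LINT \<xi>|lborel. cis (2 * pi * (w \<bullet> \<xi>)) * E \<xi>) = gauss (w /\<^sub>R t) / t ^ d" for w
  proof -
    let ?g = "\<lambda>\<eta>. cis ((w /\<^sub>R t) \<bullet> \<eta>) * gauss \<eta>"
    have gi: "integrable lborel ?g"
      by (rule Bochner_Integration.integrable_bound[OF integrable_gauss]) (auto simp: norm_mult)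
    have "complex_of_real (exp (- (norm (w /\<^sub>R t))\<^sup>2 / 2)) = c ^ d *\<^sub>R (LINT \<xi>|lborel. ?g (0 + c *\<^sub>R \<xi>))"
      using integral_lborel_affine[OF gi, of c 0] c unfolding integral_cis_gauss d_def by simp
    also have "(LINT \<xi>|lborel. ?g (0 + c *\<^sub>R \<xi>)) = (LINT \<xi>|lborel. complex_of_real (1 / sqrt (2 * pi) ^ d) * (cis (2 * pi * (w \<bullet> \<xi>)) * E \<xi>))"
      using t by (intro Bochner_Integration.integral_cong refl) (simp add: gauss_eq E_def c_def d_def field_simps)
    also have "\<dots> = complex_of_real (1 / sqrt (2 * pi) ^ d) * (LINT \<xi>|lborel. cis (2 * pi * (w \<bullet> \<xi>)) * E \<xi>)"
      by (rule integral_mult_right_zero)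
    finally have *: "complex_of_real (exp (- (norm (w /\<^sub>R t))\<^sup>2 / 2)) =
        complex_of_real (c ^ d / sqrt (2 * pi) ^ d) * (LINT \<xi>|lborel. cis (2 * pi * (w \<bullet> \<xi>)) * E \<xi>)"
      by (simp add: scaleR_conv_of_real)
    have "exp (- (norm (w /\<^sub>R t))\<^sup>2 / 2) = sqrt (2 * pi) ^ d * gauss (w /\<^sub>R t)"
      by (simp add: gauss_eq d_def)
    moreover have "c ^ d = sqrt (2 * pi) ^ d * sqrt (2 * pi) ^ d * t ^ d"
      unfolding power_mult_distrib[symmetric] by (simp add: c_def)
    ultimately have "complex_of_real (sqrt (2 * pi) ^ d) * gauss (w /\<^sub>R t) =
        complex_of_real (sqrt (2 * pi) ^ d) * (t ^ d * (LINT \<xi>|lborel. cis (2 * pi * (w \<bullet> \<xi>)) * E \<xi>))"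
      using * by simp
    then have "gauss (w /\<^sub>R t) = t ^ d * (LINT \<xi>|lborel. cis (2 * pi * (w \<bullet> \<xi>)) * E \<xi>)"
      by (subst (asm) mult_cancel_left) auto
    then show ?thesis using t by (simp add: field_simps)
  qed
  have "inv_fourier (\<lambda>\<xi>. E \<xi> * fourier f \<xi>) x = (LINT \<xi>|lborel. LINT z|lborel. F (z, \<xi>))"
    by (simp add: inv_fourier_def in1)
  also have "\<dots> = (LINT z|lborel. LINT \<xi>|lborel. F (z, \<xi>))"
    using Fi by (intro lborel_pair.Fubini_integral) simp
  also have "\<dots> = (LINT z|lborel. f z * (gauss ((x - z) /\<^sub>R t) / t ^ d))"
    by (simp add: F_def in2)
  also have "\<dots> = t ^ d *\<^sub>R (LINT y|lborel. f (x - t *\<^sub>R y) * (gauss y / t ^ d))"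
  proof -
    have gb: "gauss z \<le> 1 / sqrt (2 * pi) ^ DIM('a)" for z :: 'a
      by (auto simp: gauss_eq intro!: divide_right_mono)
    have "integrable lborel (\<lambda>z. f z * (gauss ((x - z) /\<^sub>R t) / t ^ d))"
    proof (rule Bochner_Integration.integrable_bound)
      show "integrable lborel (\<lambda>z. norm (f z) * (1 / sqrt (2 * pi) ^ DIM('a) / t ^ d))" using f by simp
      show "AE z in lborel. norm (f z * (gauss ((x - z) /\<^sub>R t) / t ^ d)) \<le> norm (norm (f z) * (1 / sqrt (2 * pi) ^ DIM('a) / t ^ d))"
      proof (rule AE_I2)
        fix z
        have "norm (f z) * (gauss ((x - z) /\<^sub>R t) / t ^ d) \<le> norm (f z) * (1 / sqrt (2 * pi) ^ DIM('a) / t ^ d)"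
          using t by (intro mult_left_mono divide_right_mono gb) auto
        then show "norm (f z * (gauss ((x - z) /\<^sub>R t) / t ^ d)) \<le> norm (norm (f z) * (1 / sqrt (2 * pi) ^ DIM('a) / t ^ d))"
          using t by (simp add: norm_mult norm_divide norm_power gauss_nonneg)
      qed
    qed measurable
    from integral_lborel_affine[OF this, of "- t" x] show ?thesis using t by (simp add: d_def)
  qed
  also have "\<dots> = mollify t f x"
    using t by (simp add: mollify_def scaleR_conv_of_real)
  finally show ?thesis by (simp add: E_def c_def)
qed

theorem fourier_inversion:
  fixes f :: "'a::euclidean_space \<Rightarrow> complex"
  assumes "f \<in> fourier_core"
  shows "AE x in lborel. inv_fourier (fourier f) x = f x"
proof -
  have f: "integrable lborel f" and ff: "integrable lborel (fourier f)" using assms by (auto simp: fourier_core_def)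
  have [measurable]: "f \<in> borel_measurable borel" "fourier f \<in> borel_measurable borel" using f by auto
  define t where "t n = inverse (real (Suc n))" for n
  have t: "t \<longlonglongrightarrow> 0" unfolding t_def by (rule LIMSEQ_inverse_real_of_nat)
  have tp: "t n > 0" for n by (simp add: t_def)
  have lim: "(\<lambda>n. mollify (t n) f x) \<longlonglongrightarrow> inv_fourier (fourier f) x" for x
    unfolding mollify_eq_inv_fourier[OF f tp] inv_fourier_def
  proof (rule integral_dominated_convergence)
    show "integrable lborel (\<lambda>\<xi>. norm (fourier f \<xi>))" using ff by simp
    show "AE \<xi> in lborel. (\<lambda>n. cis (2 * pi * (x \<bullet> \<xi>)) * (exp (- (norm ((2 * pi * t n) *\<^sub>R \<xi>))\<^sup>2 / 2) * fourier f \<xi>))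
        \<longlonglongrightarrow> cis (2 * pi * (x \<bullet> \<xi>)) * fourier f \<xi>"
    proof (rule AE_I2)
      fix \<xi> :: 'a
      have "(\<lambda>n. complex_of_real (exp (- (norm ((2 * pi * t n) *\<^sub>R \<xi>))\<^sup>2 / 2))) \<longlonglongrightarrow>
          complex_of_real (exp (- (norm ((2 * pi * 0) *\<^sub>R \<xi>))\<^sup>2 / 2))"
        by (intro tendsto_intros t) auto
      also have "complex_of_real (exp (- (norm ((2 * pi * 0) *\<^sub>R \<xi>))\<^sup>2 / 2)) = 1" by simp
      finally have "(\<lambda>n. complex_of_real (exp (- (norm ((2 * pi * t n) *\<^sub>R \<xi>))\<^sup>2 / 2))) \<longlonglongrightarrow> 1" .
      from tendsto_mult[OF tendsto_const[of "cis (2 * pi * (x \<bullet> \<xi>))"] tendsto_mult[OF this tendsto_const[of "fourier f \<xi>"]]]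
      show "(\<lambda>n. cis (2 * pi * (x \<bullet> \<xi>)) * (exp (- (norm ((2 * pi * t n) *\<^sub>R \<xi>))\<^sup>2 / 2) * fourier f \<xi>))
        \<longlonglongrightarrow> cis (2 * pi * (x \<bullet> \<xi>)) * fourier f \<xi>" by (simp only: mult_1)
    qed
    show "AE \<xi> in lborel. norm (cis (2 * pi * (x \<bullet> \<xi>)) * (exp (- (norm ((2 * pi * t n) *\<^sub>R \<xi>))\<^sup>2 / 2) * fourier f \<xi>)) \<le> norm (fourier f \<xi>)" for n
      by (intro AE_I2) (simp add: norm_mult mult_left_le_one_le)
  qed measurable
  have [measurable]: "inv_fourier (fourier f) \<in> borel_measurable borel"
    by (rule borel_measurable_LIMSEQ_metric[OF _ lim]) auto
  have "(\<integral>\<^sup>+x. ennreal (norm (inv_fourier (fourier f) x - f x)) \<partial>lborel) =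
      (\<integral>\<^sup>+x. liminf (\<lambda>n. ennreal (norm (mollify (t n) f x - f x))) \<partial>lborel)"
  proof (rule nn_integral_cong)
    fix x
    have "(\<lambda>n. ennreal (norm (mollify (t n) f x - f x))) \<longlonglongrightarrow> ennreal (norm (inv_fourier (fourier f) x - f x))"
      by (intro tendsto_ennrealI tendsto_intros lim)
    then show "ennreal (norm (inv_fourier (fourier f) x - f x)) = liminf (\<lambda>n. ennreal (norm (mollify (t n) f x - f x)))"
      by (intro lim_imp_Liminf[symmetric]) auto
  qed
  also have "\<dots> \<le> liminf (\<lambda>n. \<integral>\<^sup>+x. ennreal (norm (mollify (t n) f x - f x)) \<partial>lborel)"
    by (rule nn_integral_liminf) measurable
  also have "\<dots> = 0"
    using mollify_tendsto_L1[OF f t tp] by (simp add: lim_imp_Liminf)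
  finally have "AE x in lborel. ennreal (norm (inv_fourier (fourier f) x - f x)) = 0"
    by (subst (asm) le_zero_eq, subst (asm) nn_integral_0_iff_AE) auto
  then show ?thesis by eventually_elim simp
qed

section \<open>The multiplier with symbol one\<close>

lemma Lp_tendstoD_AE_unique:
  fixes w w' :: "'a::euclidean_space \<Rightarrow> complex"
  assumes p: "p > 0" and [measurable]: "\<And>n. f n \<in> borel_measurable borel" "w \<in> borel_measurable borel" "w' \<in> borel_measurable borel"
    and "Lp_tendsto p f w" "Lp_tendsto p f w'"
  shows "AE x in lborel. w x = w' x"
proof -
  let ?I = "\<integral>\<^sup>+x. ennreal (norm (w x - w' x) powr p) \<partial>lborel"
  have le: "?I \<le> ennreal (2 powr p) * ((\<integral>\<^sup>+x. ennreal (norm (f n x - w x) powr p) \<partial>lborel) +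
      (\<integral>\<^sup>+x. ennreal (norm (f n x - w' x) powr p) \<partial>lborel))" for n
    using nn_integral_powr_triangle[of p w lborel "f n" w'] p by (simp add: norm_minus_commute)
  have "(\<lambda>n. ennreal (2 powr p) * ((\<integral>\<^sup>+x. ennreal (norm (f n x - w x) powr p) \<partial>lborel) +
      (\<integral>\<^sup>+x. ennreal (norm (f n x - w' x) powr p) \<partial>lborel))) \<longlonglongrightarrow> ennreal (2 powr p) * (0 + 0)"
    using assms(5,6) unfolding Lp_tendsto_def by (intro ennreal_tendsto_cmult tendsto_add) simp_all
  then have "?I \<le> ennreal (2 powr p) * (0 + 0)"
    by (rule LIMSEQ_le_const) (use le in auto)
  then have "?I = 0" by simp
  then have "AE x in lborel. ennreal (norm (w x - w' x) powr p) = 0"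
    by (subst (asm) nn_integral_0_iff_AE) auto
  then show ?thesis by eventually_elim simp
qed

lemma norm_mollify_le:
  fixes f :: "'a::euclidean_space \<Rightarrow> complex"
  assumes "\<And>x. norm (f x) \<le> M" and [measurable]: "f \<in> borel_measurable borel"
  shows "norm (mollify t f x) \<le> M"
proof -
  have "norm (mollify t f x) \<le> (LINT y|(lborel::'a measure). M * gauss y)"
    unfolding mollify_def
  proof (rule Bochner_Integration.integral_norm_bound_integral)
    show i: "integrable lborel (\<lambda>y::'a. M * gauss y)" by (intro integrable_mult_right integrable_gauss)
    show b: "norm (f (x - t *\<^sub>R y) * gauss y) \<le> M * gauss y" for y
      using assms(1) by (auto simp: norm_mult gauss_nonneg intro!: mult_right_mono)
    show "integrable lborel (\<lambda>y. f (x - t *\<^sub>R y) * gauss y)"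
      by (rule Bochner_Integration.integrable_bound[OF i]) (use b in \<open>auto intro: order_trans[OF _ abs_ge_self]\<close>)
  qed
  then show ?thesis by (simp add: integral_gauss)
qed

lemma Cc_integrable:
  fixes g :: "'a::euclidean_space \<Rightarrow> complex"
  assumes g: "g \<in> Cc"
  shows "integrable lborel g"
proof -
  obtain M where M: "\<And>x. norm (g x) \<le> M" using Cc_bounded[OF g] by blast
  obtain R where R: "\<And>x. norm x > R \<Longrightarrow> g x = 0" using Cc_support_bounded[OF g] by blast
  show ?thesis
  proof (rule Bochner_Integration.integrable_bound)
    show "integrable lborel (\<lambda>x. M * indicator (cball (0::'a) R) x)"
      using emeasure_lborel_cball_finite[of "0::'a" R]
      by (intro integrable_mult_right integrable_real_indicator) auto
    show "g \<in> borel_measurable lborel" using borel_measurable_Cc[OF g] by simp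
    show "AE x in lborel. norm (g x) \<le> norm (M * indicator (cball 0 R) x)"
      using M R by (intro AE_I2) (auto simp: indicator_def abs_mult intro: order_trans[OF _ abs_ge_self])
  qed
qed

lemma fourier_core_dense_Lp:
  fixes f :: "'a::euclidean_space \<Rightarrow> complex"
  assumes p: "p \<ge> 1" and f: "f \<in> Lp p" and e: "e > (0::real)"
  shows "\<exists>g\<in>fourier_core. (\<integral>\<^sup>+x. ennreal (norm (g x - f x) powr p) \<partial>lborel) < ennreal e"
proof -
  have [measurable]: "f \<in> borel_measurable borel" using f by (auto simp: Lp_def)
  define e' where "e' = e / (2 powr p * 2)"
  have e': "e' > 0" using e by (simp add: e'_def)
  obtain g where g: "g \<in> Cc" and fg: "(\<integral>\<^sup>+x. ennreal (norm (f x - g x) powr p) \<partial>lborel) < ennreal e'"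
    using Cc_dense_Lp[OF _ f e'] p by auto
  have gi: "integrable lborel g" by (rule Cc_integrable[OF g])
  have [measurable]: "g \<in> borel_measurable borel" by (rule borel_measurable_Cc[OF g])
  obtain M where M: "M > 0" "\<And>x. norm (g x) \<le> M" using Cc_bounded[OF g] by blast
  define t where "t n = inverse (real (Suc n))" for n
  have t: "t \<longlonglongrightarrow> 0" unfolding t_def by (rule LIMSEQ_inverse_real_of_nat)
  have tp: "t n > 0" for n by (simp add: t_def)
  have "ennreal (e' / (2 * M) powr (p - 1)) > 0" using e' M by simp
  from order_tendstoD(2)[OF mollify_tendsto_L1[OF gi t tp] this]
  obtain n where n: "(\<integral>\<^sup>+x. ennreal (norm (mollify (t n) g x - g x)) \<partial>lborel) < ennreal (e' / (2 * M) powr (p - 1))"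
    by (auto simp: eventually_sequentially)
  let ?h = "mollify (t n) g"
  have "(\<integral>\<^sup>+x. ennreal (norm (?h x - g x) powr p) \<partial>lborel) \<le>
      (\<integral>\<^sup>+x. ennreal ((2 * M) powr (p - 1)) * ennreal (norm (?h x - g x)) \<partial>lborel)"
  proof (rule nn_integral_mono)
    fix x
    let ?z = "norm (?h x - g x)"
    have z: "?z \<le> 2 * M"
      using norm_triangle_ineq4[of "?h x" "g x"] M(2)[of x] norm_mollify_le[of g M "t n" x, OF M(2)] by simp
    have "?z powr p = ?z powr (p - 1) * ?z"
      using powr_add[of ?z "p - 1" 1] by simp
    also have "\<dots> \<le> (2 * M) powr (p - 1) * ?z"
      using z p by (intro mult_right_mono powr_mono2) auto
    finally show "ennreal (?z powr p) \<le> ennreal ((2 * M) powr (p - 1)) * ennreal ?z"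
      by (simp flip: ennreal_mult)
  qed
  also have "\<dots> = ennreal ((2 * M) powr (p - 1)) * (\<integral>\<^sup>+x. ennreal (norm (?h x - g x)) \<partial>lborel)"
    by (rule nn_integral_cmult) measurable
  also have "\<dots> < ennreal ((2 * M) powr (p - 1)) * ennreal (e' / (2 * M) powr (p - 1))"
    using M by (intro ennreal_mult_strict_left_mono n) auto
  also have "\<dots> = ennreal e'" using M e' by (simp flip: ennreal_mult)
  finally have hg: "(\<integral>\<^sup>+x. ennreal (norm (?h x - g x) powr p) \<partial>lborel) < ennreal e'" .
  have "(\<integral>\<^sup>+x. ennreal (norm (?h x - f x) powr p) \<partial>lborel) \<le> ennreal (2 powr p) *
      ((\<integral>\<^sup>+x. ennreal (norm (?h x - g x) powr p) \<partial>lborel) + (\<integral>\<^sup>+x. ennreal (norm (g x - f x) powr p) \<partial>lborel))"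
    using p by (intro nn_integral_powr_triangle) auto
  also have "\<dots> < ennreal (2 powr p) * (ennreal e' + ennreal e')"
    using fg by (intro ennreal_mult_strict_left_mono add_strict_mono hg) (auto simp: norm_minus_commute)
  also have "\<dots> = ennreal e"
    using e by (simp add: e'_def flip: ennreal_plus ennreal_mult)
  finally show ?thesis using mollify_in_fourier_core[OF gi tp] by blast
qed

lemma is_multiplier_image_one_iff:
  fixes f :: "'a::euclidean_space \<Rightarrow> complex"
  assumes p: "p \<ge> 1" and f: "f \<in> Lp p"
  shows "is_multiplier_image p (\<lambda>_. 1) f w \<longleftrightarrow> w \<in> Lp p \<and> (AE x in lborel. w x = f x)"
proof -
  have [measurable]: "f \<in> borel_measurable borel" using f by (auto simp: Lp_def)
  have core: "Lp_tendsto p (\<lambda>n. inv_fourier (\<lambda>\<xi>. homogeneous_ext (\<lambda>_. 1) \<xi> * fourier (g n) \<xi>)) w \<longleftrightarrow> Lp_tendsto p g w"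
    if "\<And>n. g n \<in> fourier_core" for g and w :: "'a \<Rightarrow> complex"
  proof -
    have "(\<integral>\<^sup>+x. ennreal (norm (inv_fourier (fourier (g n)) x - w x) powr p) \<partial>lborel) =
        (\<integral>\<^sup>+x. ennreal (norm (g n x - w x) powr p) \<partial>lborel)" for n
      using fourier_inversion[OF that[of n]] by (intro nn_integral_cong_AE) (auto elim: eventually_mono)
    then show ?thesis by (simp add: Lp_tendsto_def homogeneous_ext_def)
  qed
  have gm: "g \<in> fourier_core \<Longrightarrow> g \<in> borel_measurable borel" for g :: "'a \<Rightarrow> complex"
    by (auto simp: fourier_core_def)
  show ?thesis
  proof safe
    assume w: "is_multiplier_image p (\<lambda>_. 1) f w"
    then show "w \<in> Lp p" by (simp add: is_multiplier_image_def)
    then have [measurable]: "w \<in> borel_measurable borel" by (simp add: Lp_def)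
    from w obtain g where g: "\<And>n. g n \<in> fourier_core" "Lp_tendsto p g f" "Lp_tendsto p g w"
      unfolding is_multiplier_image_def using core by blast
    show "AE x in lborel. w x = f x"
      using p by (intro Lp_tendstoD_AE_unique[OF _ gm[OF g(1)] _ _ g(3,2)]) auto
  next
    assume w: "w \<in> Lp p" "AE x in lborel. w x = f x"
    have "\<exists>g\<in>fourier_core. (\<integral>\<^sup>+x. ennreal (norm (g x - f x) powr p) \<partial>lborel) < ennreal (inverse (real (Suc n)))" for n
      by (rule fourier_core_dense_Lp[OF p f]) simp
    then obtain g where g: "\<And>n. g n \<in> fourier_core"
      "\<And>n. (\<integral>\<^sup>+x. ennreal (norm (g n x - f x) powr p) \<partial>lborel) < ennreal (inverse (real (Suc n)))"
      by metis
    have "(\<lambda>n. ennreal (inverse (real (Suc n)))) \<longlonglongrightarrow> ennreal 0"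
      by (intro tendsto_ennrealI LIMSEQ_inverse_real_of_nat)
    then have "(\<lambda>n. ennreal (inverse (real (Suc n)))) \<longlonglongrightarrow> 0" by simp
    then have gf: "Lp_tendsto p g f"
      unfolding Lp_tendsto_def
      by (rule tendsto_sandwich[OF _ _ tendsto_const, rotated 2])
        (auto intro!: always_eventually intro: less_imp_le g(2) simp del: of_nat_Suc)
    have "(\<integral>\<^sup>+x. ennreal (norm (g n x - w x) powr p) \<partial>lborel) =
        (\<integral>\<^sup>+x. ennreal (norm (g n x - f x) powr p) \<partial>lborel)" for n
      using w(2) by (intro nn_integral_cong_AE) (auto elim: eventually_mono)
    with gf have "Lp_tendsto p g w" by (simp add: Lp_tendsto_def)
    then show "is_multiplier_image p (\<lambda>_. 1) f w"
      unfolding is_multiplier_image_def using w(1) g(1) gf core by blast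
  qed
qed

lemma
  assumes "p \<ge> 1" and f: "f \<in> Lp p"
  shows multiplier_op_one_in_Lp: "multiplier_op p (\<lambda>_. 1) f \<in> Lp p"
    and multiplier_op_one_AE: "AE x in lborel. multiplier_op p (\<lambda>_. 1) f x = f x"
proof -
  have "is_multiplier_image p (\<lambda>_. 1) f (multiplier_op p (\<lambda>_. 1) f)"
    unfolding multiplier_op_def
    by (rule someI[of _ f]) (simp add: is_multiplier_image_one_iff[OF assms] f)
  then show "multiplier_op p (\<lambda>_. 1) f \<in> Lp p" "AE x in lborel. multiplier_op p (\<lambda>_. 1) f x = f x"
    by (simp_all add: is_multiplier_image_one_iff[OF assms])
qed

section \<open>Multiplication of VMO by Lipschitz functions\<close>

lemma set_integrable_ball: "f \<in> L1_loc \<Longrightarrow> set_integrable lborel (ball c r) f"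
  unfolding L1_loc_def by (auto intro: set_integrable_subset[OF _ _ ball_subset_cball])

lemma set_integrable_const_ball:
  fixes z :: "'b::{banach, second_countable_topology}"
  shows "set_integrable lborel (ball c r) (\<lambda>_. z)"
  unfolding set_integrable_def using emeasure_lborel_ball_finite[of c r]
  by (intro integrable_scaleR_left integrable_real_indicator) auto

lemma set_integral_const_ball:
  fixes z :: "'b::{banach, second_countable_topology}"
  shows "(LINT x:ball c r|lborel. z) = measure lborel (ball c r) *\<^sub>R z"
  unfolding set_lebesgue_integral_def using emeasure_lborel_ball_finite[of c r]
  by (subst integral_scaleR_left) auto

lemma set_integral_mono_subset:
  fixes f :: "'b \<Rightarrow> real"
  assumes "set_integrable M B f" "\<And>x. 0 \<le> f x" "A \<subseteq> B" "A \<in> sets M"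
  shows "(LINT x:A|M. f x) \<le> (LINT x:B|M. f x)"
  using assms set_integrable_subset[OF assms(1,4,3)]
  unfolding set_lebesgue_integral_def set_integrable_def
  by (intro integral_mono) (auto simp: indicator_def)

lemma measure_ball_mono:
  fixes c c' :: "'a::euclidean_space"
  assumes "0 \<le> r" "r \<le> s"
  shows "measure lborel (ball c r) \<le> measure lborel (ball c' s)"
  using assms by (simp add: content_ball_conv_unit_ball[of _ c] content_ball_conv_unit_ball[of _ c']
      mult_right_mono power_mono)

lemma norm_mean_diff_le:
  assumes f: "set_integrable lborel (ball c r) f" and r: "r > 0"
  shows "norm (mean f (ball c r) - a) \<le> (LINT x:ball c r|lborel. norm (f x - a)) / measure lborel (ball c r)"
proof -
  let ?B = "ball c r" and ?m = "measure lborel (ball c r)"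
  have m: "?m > 0" using r by (simp add: content_ball_pos)
  have ca: "set_integrable lborel ?B (\<lambda>_. a)"
    by (rule set_integrable_const_ball)
  have "(LINT x:?B|lborel. f x - a) = (LINT x:?B|lborel. f x) - ?m *\<^sub>R a"
    using f ca by (subst set_integral_diff(2)) (auto simp: set_integral_const_ball)
  then have "mean f ?B - a = (LINT x:?B|lborel. f x - a) /\<^sub>R ?m"
    using m by (simp add: mean_def scaleR_diff_right)
  moreover have "norm (LINT x:?B|lborel. f x - a) \<le> (LINT x:?B|lborel. norm (f x - a))"
    by (intro set_integral_norm_bound set_integral_diff f ca)
  ultimately show ?thesis using m by (simp add: divide_inverse mult.commute)
qed

lemma mean_oscillation_le:
  assumes f: "set_integrable lborel (ball c r) f" and r: "r > 0"
  shows "mean_oscillation f (ball c r) \<le> 2 * ((LINT x:ball c r|lborel. norm (f x - a)) / measure lborel (ball c r))"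
proof -
  let ?B = "ball c r" and ?m = "measure lborel (ball c r)" and ?b = "mean f (ball c r)"
  have m: "?m > 0" using r by (simp add: content_ball_pos)
  have ca: "set_integrable lborel ?B (\<lambda>_. z)" for z :: complex
    by (rule set_integrable_const_ball)
  have ca': "set_integrable lborel ?B (\<lambda>_. z)" for z :: real
    by (rule set_integrable_const_ball)
  have fa: "set_integrable lborel ?B (\<lambda>x. norm (f x - z))" for z
    by (intro set_integrable_norm set_integral_diff f ca)
  have "(LINT x:?B|lborel. norm (f x - ?b)) \<le> (LINT x:?B|lborel. norm (f x - a) + norm (?b - a))"
    by (intro set_integral_mono fa set_integral_add ca') norm
  also have "\<dots> = (LINT x:?B|lborel. norm (f x - a)) + ?m * norm (?b - a)"
    by (subst set_integral_add(2)[OF fa ca']) (simp add: set_integral_const_ball)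
  also have "?m * norm (?b - a) \<le> (LINT x:?B|lborel. norm (f x - a))"
    using norm_mean_diff_le[OF f r, of a] m by (simp add: field_simps)
  finally show ?thesis using m by (simp add: mean_oscillation_def divide_right_mono)
qed

lemma mean_oscillation_le_BMO_norm:
  assumes "BMO_norm f < ennreal e" "r > 0"
  shows "mean_oscillation f (ball c r) \<le> e"
proof -
  have "ennreal (mean_oscillation f (ball c r)) \<le> BMO_norm f"
    unfolding BMO_norm_def using assms(2) by (intro SUP_upper2[of "(c, r)"]) auto
  also note assms(1)
  finally show ?thesis by (meson ennreal_leI ennreal_less_iff linorder_not_less nle_le)
qed

lemma BMO_norm_leI:
  assumes "\<And>c r. r > 0 \<Longrightarrow> mean_oscillation f (ball c r) \<le> e"
  shows "BMO_norm f \<le> ennreal e"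
  unfolding BMO_norm_def using assms by (auto intro!: SUP_least ennreal_leI)

lemma Linf_imp_L1_loc: "f \<in> Linf \<Longrightarrow> f \<in> L1_loc"
proof -
  assume "f \<in> Linf"
  then obtain C where [measurable]: "f \<in> borel_measurable borel" and C: "AE x in lborel. norm (f x) \<le> C"
    by (auto simp: Linf_def)
  have "set_integrable lborel K f" if K: "compact K" for K
    unfolding set_integrable_def
  proof (rule Bochner_Integration.integrable_bound)
    have [measurable]: "K \<in> sets borel" using K by (simp add: borel_compact)
    show "integrable lborel (\<lambda>x. indicator K x *\<^sub>R C)"
      using emeasure_compact_finite[OF K] by simp
    show "(\<lambda>x. indicator K x *\<^sub>R f x) \<in> borel_measurable lborel" by measurable
    show "AE x in lborel. norm (indicator K x *\<^sub>R f x) \<le> norm (indicator K x *\<^sub>R C)"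
      using C by eventually_elim (auto simp: indicator_def)
  qed
  then show ?thesis by (auto simp: L1_loc_def)
qed

lemma Linf_imp_BMO:
  assumes f: "f \<in> Linf"
  shows "f \<in> BMO"
proof -
  note fl = Linf_imp_L1_loc[OF f]
  obtain C where [measurable]: "f \<in> borel_measurable borel" and C: "AE x in lborel. norm (f x) \<le> C"
    using f by (auto simp: Linf_def)
  have "mean_oscillation f (ball c r) \<le> 2 * C" if r: "r > 0" for c r
  proof -
    have m: "measure lborel (ball c r) > 0" using r by (simp add: content_ball_pos)
    have "(LINT x:ball c r|lborel. norm (f x - 0)) \<le> (LINT x:ball c r|lborel. C)"
      using C set_integrable_ball[OF fl]
      by (intro set_integral_mono_AE set_integrable_norm set_integrable_const_ball) auto
    also have "\<dots> = measure lborel (ball c r) * C"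
      by (simp add: set_integral_const_ball)
    finally have "(LINT x:ball c r|lborel. norm (f x - 0)) / measure lborel (ball c r) \<le> C"
      using m by (simp add: field_simps)
    then show ?thesis
      using mean_oscillation_le[OF set_integrable_ball[OF fl] r, of c 0] by simp
  qed
  from BMO_norm_leI[OF this] show ?thesis using fl by (auto simp: BMO_def le_less_trans)
qed

lemma Cc_imp_Linf:
  assumes g: "g \<in> Cc"
  shows "g \<in> Linf"
  using Cc_bounded[OF g] borel_measurable_Cc[OF g] by (auto simp: Linf_def)

lemma Cc_subset_VMO: "g \<in> Cc \<Longrightarrow> g \<in> VMO"
proof -
  assume g: "g \<in> Cc"
  have "BMO_norm (\<lambda>x. g x - g x) \<le> ennreal 0"
    by (rule BMO_norm_leI) (simp add: mean_oscillation_def mean_def)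
  then show ?thesis
    using g Linf_imp_BMO[OF Cc_imp_Linf[OF g]] by (auto simp: VMO_def intro!: bexI[of _ g])
qed

lemma mean_ball_chain:
  fixes h :: "'a::euclidean_space \<Rightarrow> complex"
  assumes h: "h \<in> L1_loc" and osc: "\<And>c r. r > 0 \<Longrightarrow> mean_oscillation h (ball c r) \<le> e" and r: "r > 0"
  shows "norm (mean h (ball c r) - mean h (ball c (2 ^ k * r))) \<le> real k * (2 ^ DIM('a) * e)"
proof (induction k)
  case (Suc k)
  let ?r = "2 ^ k * r"
  let ?b = "mean h (ball c (2 * ?r))"
  have r': "?r > 0" using r by simp
  have m: "measure lborel (ball c (2 * ?r)) = 2 ^ DIM('a) * measure lborel (ball c ?r)"
    using r content_ball_conv_unit_ball[of ?r c] content_ball_conv_unit_ball[of "2 * ?r" c]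
    by (simp add: power_mult_distrib)
  have mp: "measure lborel (ball c ?r) > 0" using r' by (simp add: content_ball_pos)
  have hi: "set_integrable lborel (ball c (2 * ?r)) (\<lambda>x. norm (h x - ?b))"
    by (rule set_integrable_norm, rule set_integral_diff(1)[OF set_integrable_ball[OF h] set_integrable_const_ball])
  have "norm (mean h (ball c ?r) - ?b) \<le> (LINT x:ball c ?r|lborel. norm (h x - ?b)) / measure lborel (ball c ?r)"
    using norm_mean_diff_le[OF set_integrable_ball[OF h] r'] .
  also have "\<dots> \<le> (LINT x:ball c (2 * ?r)|lborel. norm (h x - ?b)) / measure lborel (ball c ?r)"
    using r by (intro divide_right_mono set_integral_mono_subset[OF hi] subset_ball) auto
  also have "\<dots> = 2 ^ DIM('a) * mean_oscillation h (ball c (2 * ?r))"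
    unfolding mean_oscillation_def m using mp by simp
  also have "\<dots> \<le> 2 ^ DIM('a) * e"
    using osc[of "2 * ?r"] r' by (intro mult_left_mono) auto
  finally have *: "norm (mean h (ball c ?r) - mean h (ball c (2 ^ Suc k * r))) \<le> 2 ^ DIM('a) * e"
    by (simp add: mult.assoc)
  have "norm (mean h (ball c r) - mean h (ball c (2 ^ Suc k * r))) \<le>
    norm (mean h (ball c r) - mean h (ball c ?r)) + norm (mean h (ball c ?r) - mean h (ball c (2 ^ Suc k * r)))"
    by norm
  also have "\<dots> \<le> real k * (2 ^ DIM('a) * e) + 2 ^ DIM('a) * e"
    by (intro add_mono * Suc.IH)
  finally show ?case by (simp add: algebra_simps)
qed simp

lemma mean_oscillation_mult_Lipschitz:
  fixes h0 \<phi> :: "'a::euclidean_space \<Rightarrow> complex"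
  assumes h0: "h0 \<in> L1_loc" and osc: "\<And>c r. r > 0 \<Longrightarrow> mean_oscillation h0 (ball c r) \<le> e"
    and R: "R > 0" and \<phi>m: "\<phi> \<in> borel_measurable borel"
    and M: "\<And>x. norm (\<phi> x) \<le> M" and L: "\<And>x y. norm (\<phi> x - \<phi> y) \<le> L * norm (x - y)"
    and supp: "\<And>x. norm x \<ge> R \<Longrightarrow> \<phi> x = 0" and r: "r > 0"
  shows "mean_oscillation (\<lambda>x. (h0 x - mean h0 (ball 0 (4 * R))) * \<phi> x) (ball c r) \<le>
     2 * e * (4 ^ DIM('a) * (M + 3 * L * R))"
proof -
  define d where "d = DIM('a)"
  let ?A = "ball (0::'a) (4 * R)" and ?B = "ball c r"
  let ?a = "mean h0 ?A"
  let ?m = "\<lambda>r. measure lborel (ball (0::'a) r)"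
  let ?h = "\<lambda>x. h0 x - ?a"
  let ?\<mu> = "measure lborel ?B"
  have mp: "?m s > 0" if "s > 0" for s using that by (simp add: content_ball_pos)
  have mR: "?m (4 * R) = 4 ^ d * ?m R"
    using R content_ball_conv_unit_ball[of "4 * R" "0::'a"] content_ball_conv_unit_ball[of R "0::'a"]
    by (simp add: power_mult_distrib d_def)
  have \<mu>: "?\<mu> > 0" using r by (simp add: content_ball_pos)
  have e0: "e \<ge> 0"
    using osc[OF R, of 0] by (rule order_trans[rotated])
      (auto simp: mean_oscillation_def set_lebesgue_integral_def intro!: divide_nonneg_nonneg integral_nonneg)
  have M0: "M \<ge> 0" using M[of 0] norm_ge_zero order_trans by blast
  have L0: "L \<ge> 0"
  proof -
    obtain b :: 'a where b: "b \<in> Basis" using nonempty_Basis by blast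
    have "0 \<le> L * norm (b - 0)" using L[of b 0] norm_ge_zero order_trans by blast
    then show ?thesis using b by simp
  qed
  have hi: "set_integrable lborel (ball x s) (\<lambda>x. h0 x - z)" for x s z
    by (rule set_integral_diff(1)[OF set_integrable_ball[OF h0] set_integrable_const_ball])
  have h\<phi>: "set_integrable lborel (ball x s) (\<lambda>x. (h0 x - z) * \<phi> x)" for x s z
  proof (rule set_integrable_bound[OF set_integrable_mult_right[OF hi[of x s z]]])
    show "set_borel_measurable lborel (ball x s) (\<lambda>x. (h0 x - z) * \<phi> x)"
    proof -
      have [measurable]: "h0 \<in> borel_measurable borel" "\<phi> \<in> borel_measurable borel"
        using h0 \<phi>m by (auto simp: L1_loc_def)
      have "(\<lambda>x. (h0 x - z) * \<phi> x) \<in> borel_measurable borel" by measurable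
      then show ?thesis
        unfolding set_borel_measurable_def by (simp add: borel_measurable_scaleR borel_measurable_indicator)
    qed
    show "AE y in lborel. y \<in> ball x s \<longrightarrow> norm ((h0 y - z) * \<phi> y) \<le> norm (complex_of_real M * (h0 y - z))"
      using M M0 by (auto simp: norm_mult mult.commute intro!: mult_right_mono)
  qed
  have B0: "(LINT x:?A|lborel. norm (?h x)) \<le> ?m (4 * R) * e"
    using osc[of "4 * R" 0] R mp[of "4 * R"] by (simp add: mean_oscillation_def field_simps)
  consider "r \<ge> R" | "r < R" "?B \<inter> ball 0 R = {}" | "r < R" "?B \<inter> ball 0 R \<noteq> {}" by linarith
  then show ?thesis
  proof cases
    case 1
    have "(LINT x:?B|lborel. norm (?h x * \<phi> x - 0)) \<le> (LINT x:?A|lborel. norm (?h x * \<phi> x))"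
    proof -
      have "(LINT x:?B|lborel. norm (?h x * \<phi> x - 0)) = (LINT x:?B \<inter> ?A|lborel. norm (?h x * \<phi> x))"
        unfolding set_lebesgue_integral_def using R supp
        by (intro Bochner_Integration.integral_cong) (auto simp: indicator_def)
      also have "\<dots> \<le> (LINT x:?A|lborel. norm (?h x * \<phi> x))"
        by (rule set_integral_mono_subset[OF set_integrable_norm[OF h\<phi>]]) auto
      finally show ?thesis .
    qed
    also have "\<dots> \<le> (LINT x:?A|lborel. M * norm (?h x))"
      using M by (intro set_integral_mono set_integrable_norm h\<phi> set_integrable_mult_right hi)
        (auto simp: norm_mult mult.commute intro!: mult_right_mono)
    also have "\<dots> \<le> M * (?m (4 * R) * e)"
      using B0 M0 by (simp add: mult_left_mono)
    also have "\<dots> = (4 ^ d * M * e) * ?m R" by (simp add: mR)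
    also have "\<dots> \<le> (4 ^ d * M * e) * ?\<mu>"
      using 1 R M0 e0 by (intro mult_left_mono measure_ball_mono) auto
    finally have "(LINT x:?B|lborel. norm (?h x * \<phi> x - 0)) / ?\<mu> \<le> 4 ^ d * M * e"
      using \<mu> by (simp add: field_simps)
    then have "mean_oscillation (\<lambda>x. ?h x * \<phi> x) ?B \<le> 2 * (4 ^ d * M * e)"
      using mean_oscillation_le[OF h\<phi>[of c r ?a] r, of 0] by simp
    also have "\<dots> \<le> 2 * e * (4 ^ d * (M + 3 * L * R))"
      using e0 M0 L0 R by (simp add: algebra_simps)
    finally show ?thesis by (simp add: d_def)
  next
    case 2
    then have z: "\<phi> x = 0" if "x \<in> ?B" for x
      using supp[of x] that 2(2) by (cases "norm x < R") auto
    have "(LINT x:?B|lborel. norm (?h x * \<phi> x - 0)) = (LINT x:?B|lborel. 0)"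
      by (rule set_lebesgue_integral_cong) (auto simp: z)
    then have "mean_oscillation (\<lambda>x. ?h x * \<phi> x) ?B \<le> 0"
      using mean_oscillation_le[OF h\<phi>[of c r ?a] r, of 0] by simp
    also have "0 \<le> 2 * e * (4 ^ d * (M + 3 * L * R))" using e0 M0 L0 R by simp
    finally show ?thesis by (simp add: d_def)
  next
    case 3
    then have c: "norm c < 2 * R"
    proof -
      obtain y where "dist c y < r" "norm y < R" using 3 by auto
      then show ?thesis using 3(1) norm_triangle_ineq[of "c - y" y] by (simp add: dist_norm)
    qed
    obtain j where "R / r < 2 ^ j" using real_arch_pow[of 2 "R / r"] by auto
    then have j: "R \<le> 2 ^ j * r" using r by (simp add: field_simps)
    define k where "k = (LEAST j. R \<le> 2 ^ j * r)"
    have k: "R \<le> 2 ^ k * r" unfolding k_def using j by (rule LeastI)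
    have k2: "2 ^ k * r < 2 * R"
    proof (cases k)
      case (Suc i)
      then have "\<not> R \<le> 2 ^ i * r" unfolding k_def by (metis k_def lessI not_less_Least)
      then show ?thesis using Suc by simp
    qed (use 3 R in auto)
    define s where "s = 2 ^ k * r"
    have s: "R \<le> s" "s < 2 * R" "s > 0" using k k2 R by (auto simp: s_def)
    have sub: "ball c s \<subseteq> ?A"
    proof
      fix y assume "y \<in> ball c s"
      then show "y \<in> ?A" using c s norm_triangle_ineq[of "y - c" c] by (simp add: dist_norm norm_minus_commute)
    qed
    have "norm (mean h0 (ball c s) - ?a) \<le> (LINT x:ball c s|lborel. norm (?h x)) / measure lborel (ball c s)"
      by (rule norm_mean_diff_le[OF set_integrable_ball[OF h0] s(3)])
    also have "\<dots> \<le> (?m (4 * R) * e) / ?m R"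
    proof (rule frac_le)
      show "(LINT x:ball c s|lborel. norm (?h x)) \<le> ?m (4 * R) * e"
        by (rule order_trans[OF set_integral_mono_subset[OF set_integrable_norm[OF hi]] B0]) (use sub in auto)
      show "?m R \<le> measure lborel (ball c s)"
        using s R by (intro measure_ball_mono) auto
    qed (use mp[OF R] mp[of "4 * R"] R e0 in auto)
    also have "\<dots> = 4 ^ d * e" using mp[OF R] by (simp add: mR)
    finally have 1: "norm (mean h0 (ball c s) - ?a) \<le> 4 ^ d * e" .
    have 2: "norm (mean h0 ?B - mean h0 (ball c s)) \<le> real k * (2 ^ d * e)"
      unfolding s_def d_def by (rule mean_ball_chain[OF h0 osc r])
    define b where "b = mean h0 ?B"
    have ba: "norm (b - ?a) \<le> 4 ^ d * e + real k * (2 ^ d * e)"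
      using norm_triangle_ineq[of "b - mean h0 (ball c s)" "mean h0 (ball c s) - ?a"] 1 2
      by (simp add: b_def)
    have kr: "real k * r \<le> 2 * R"
    proof -
      have "real k * r \<le> 2 ^ k * r"
        using r of_nat_less_two_power[of k, where 'a = real] by (intro mult_right_mono) auto
      then show ?thesis using k2 by simp
    qed
    have pt: "norm (?h x * \<phi> x - (b - ?a) * \<phi> c) \<le> M * norm (h0 x - b) + norm (b - ?a) * (L * r)" if "x \<in> ?B" for x
    proof -
      have "?h x * \<phi> x - (b - ?a) * \<phi> c = (h0 x - b) * \<phi> x + (b - ?a) * (\<phi> x - \<phi> c)"
        by (simp add: algebra_simps)
      then have "norm (?h x * \<phi> x - (b - ?a) * \<phi> c) \<le> norm (h0 x - b) * norm (\<phi> x) + norm (b - ?a) * norm (\<phi> x - \<phi> c)"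
        by (metis norm_triangle_ineq norm_mult)
      also have "\<dots> \<le> norm (h0 x - b) * M + norm (b - ?a) * (L * r)"
        using that L0 by (intro add_mono mult_left_mono M order_trans[OF L])
          (auto simp: dist_norm norm_minus_commute)
      finally show ?thesis by (simp add: mult.commute)
    qed
    have "(LINT x:?B|lborel. norm (?h x * \<phi> x - (b - ?a) * \<phi> c)) \<le>
        (LINT x:?B|lborel. M * norm (h0 x - b) + norm (b - ?a) * (L * r))"
      by (intro set_integral_mono set_integrable_norm set_integral_diff(1) h\<phi> set_integrable_const_ball
          set_integral_add(1) set_integrable_mult_right hi pt)
    also have "\<dots> = M * (LINT x:?B|lborel. norm (h0 x - b)) + ?\<mu> * (norm (b - ?a) * (L * r))"
      by (subst set_integral_add(2))
         (auto intro!: set_integrable_mult_right set_integrable_norm hi set_integrable_const_ball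
           simp: set_integral_const_ball)
    also have "\<dots> \<le> M * (?\<mu> * e) + ?\<mu> * (norm (b - ?a) * (L * r))"
      using osc[OF r, of c] \<mu> M0
      by (intro add_right_mono mult_left_mono) (simp_all add: mean_oscillation_def b_def field_simps)
    finally have "(LINT x:?B|lborel. norm (?h x * \<phi> x - (b - ?a) * \<phi> c)) \<le> ?\<mu> * (M * e + norm (b - ?a) * (L * r))"
      by (simp add: distrib_left mult.left_commute)
    then have "(LINT x:?B|lborel. norm (?h x * \<phi> x - (b - ?a) * \<phi> c)) / ?\<mu> \<le> M * e + norm (b - ?a) * (L * r)"
      using \<mu> by (simp add: field_simps)
    also have "norm (b - ?a) * (L * r) \<le> (4 ^ d * e + real k * (2 ^ d * e)) * (L * r)"
      using ba L0 r by (intro mult_right_mono) auto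
    also have "\<dots> = L * e * (4 ^ d * r + 2 ^ d * (real k * r))" by (simp add: algebra_simps)
    also have "\<dots> \<le> L * e * (4 ^ d * R + 4 ^ d * (2 * R))"
    proof -
      have "2 ^ d * (real k * r) \<le> 4 ^ d * (2 * R)"
        by (rule mult_mono[OF _ kr]) (use r in \<open>auto intro: power_mono\<close>)
      then show ?thesis using L0 e0 3 by (intro mult_left_mono add_mono) auto
    qed
    also have "M * e \<le> 4 ^ d * M * e"
      using mult_right_mono[of 1 "4 ^ d" "M * e"] M0 e0 by (simp add: mult.assoc)
    finally have "(LINT x:?B|lborel. norm (?h x * \<phi> x - (b - ?a) * \<phi> c)) / ?\<mu> \<le>
        e * (4 ^ d * (M + 3 * L * R))"
      by (simp add: algebra_simps)
    then show ?thesis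
      using mean_oscillation_le[OF h\<phi>[of c r ?a] r, of "(b - ?a) * \<phi> c"] by (simp add: d_def)
  qed
qed

lemma VMO_mult_Lipschitz:
  fixes Q \<phi> :: "'a::euclidean_space \<Rightarrow> complex"
  assumes Q: "Q \<in> Linf \<inter> VMO" and \<phi>: "\<phi> \<in> Cc"
    and L: "\<And>x y. norm (\<phi> x - \<phi> y) \<le> L * norm (x - y)"
  shows "(\<lambda>x. Q x * \<phi> x) \<in> Linf \<inter> VMO"
proof
  have \<phi>m: "\<phi> \<in> borel_measurable borel" using borel_measurable_Cc[OF \<phi>] .
  obtain C0 M where C0: "AE x in lborel. norm (Q x) \<le> C0" and Qm: "Q \<in> borel_measurable borel"
    and M0: "M > 0" and M: "\<And>x. norm (\<phi> x) \<le> M"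
    using Q Cc_bounded[OF \<phi>] by (auto simp: Linf_def)
  show Linf: "(\<lambda>x. Q x * \<phi> x) \<in> Linf"
    unfolding Linf_def
  proof (intro CollectI conjI exI)
    show "(\<lambda>x. Q x * \<phi> x) \<in> borel_measurable lborel" using Qm \<phi>m by simp
    show "AE x in lborel. norm (Q x * \<phi> x) \<le> C0 * M"
      using C0 by eventually_elim (auto simp: norm_mult intro!: mult_mono M intro: order_trans[OF norm_ge_zero])
  qed
  obtain R0 where R0: "R0 > 0" "\<And>x. norm x > R0 \<Longrightarrow> \<phi> x = 0"
    using Cc_support_bounded[OF \<phi>] by blast
  define R where "R = R0 + 1"
  have R: "R > 0" using R0 by (simp add: R_def)
  have supp: "\<phi> x = 0" if "norm x \<ge> R" for x
    using R0(2)[of x] that by (simp add: R_def)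
  define C where "C = 2 * (4 ^ DIM('a) * (M + 3 * \<bar>L\<bar> * R))"
  have C: "C > 0" using M0 R by (simp add: C_def add_pos_nonneg)
  have "\<exists>g\<in>Cc. BMO_norm (\<lambda>x. Q x * \<phi> x - g x) < \<epsilon>" if "\<epsilon> > 0" for \<epsilon>
  proof -
    obtain \<epsilon>1 where \<epsilon>1: "0 < \<epsilon>1" "\<epsilon>1 < \<epsilon>" using \<open>\<epsilon> > 0\<close> dense by blast
    then obtain \<delta> where \<delta>: "\<epsilon>1 = ennreal \<delta>" "\<delta> > 0"
      by (cases \<epsilon>1) auto
    obtain g where g: "g \<in> Cc" "BMO_norm (\<lambda>x. Q x - g x) < ennreal (\<delta> / C)"
    proof -
      have "ennreal (\<delta> / C) > 0" using C \<delta>(2) by simp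
      then show ?thesis using Q that unfolding VMO_def by blast
    qed
    let ?h = "\<lambda>x. Q x - g x"
    let ?a = "mean ?h (ball 0 (4 * R))"
    have h: "?h \<in> L1_loc"
      using Q Linf_imp_L1_loc[of Q] Linf_imp_L1_loc[OF Cc_imp_Linf[OF g(1)]] by (auto simp: L1_loc_def)
    have "mean_oscillation (\<lambda>x. (?h x - ?a) * \<phi> x) (ball c r) \<le> 2 * (\<delta> / C) * (4 ^ DIM('a) * (M + 3 * \<bar>L\<bar> * R))"
      if "r > 0" for c r
      using that supp M
      by (intro mean_oscillation_mult_Lipschitz h R \<phi>m mean_oscillation_le_BMO_norm[OF g(2)]
        order_trans[OF L] mult_right_mono) auto
    moreover have "2 * (\<delta> / C) * (4 ^ DIM('a) * (M + 3 * \<bar>L\<bar> * R)) = \<delta>"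
      using C by (simp add: C_def field_simps)
    ultimately have "BMO_norm (\<lambda>x. (?h x - ?a) * \<phi> x) \<le> ennreal \<delta>" by (intro BMO_norm_leI) simp
    then have "BMO_norm (\<lambda>x. Q x * \<phi> x - (g x + ?a) * \<phi> x) < \<epsilon>"
      using \<epsilon>1 \<delta> by (simp add: algebra_simps)
    moreover have "(\<lambda>x. (g x + ?a) * \<phi> x) \<in> Cc"
      using g(1) \<phi> supp by (intro Cc_I[where R = R]) (auto simp: Cc_def intro!: continuous_intros)
    ultimately show ?thesis by (rule bexI)
  qed
  then show "(\<lambda>x. Q x * \<phi> x) \<in> VMO" using Linf_imp_BMO[OF Linf] by (auto simp: VMO_def)
qed

section \<open>Limits of products\<close>

lemma Ck_on_const: "Ck_on k S (\<lambda>_. c)"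
  by (induction k arbitrary: c) simp_all

lemma one_in_Ck_sphere: "(\<lambda>_. 1) \<in> Ck_sphere k"
  by (simp add: Ck_sphere_def homogeneous_ext_def[abs_def] Ck_on_const)

lemma test_function_imp_Cc: "\<phi> \<in> test_functions \<Longrightarrow> \<phi> \<in> Cc"
  by (auto simp: test_functions_def Cc_def dest: spec[of _ 0])

lemma test_function_Lipschitz:
  fixes \<phi> :: "'a::euclidean_space \<Rightarrow> complex"
  assumes \<phi>: "\<phi> \<in> test_functions"
  shows "\<exists>L. \<forall>x y. norm (\<phi> x - \<phi> y) \<le> L * norm (x - y)"
proof -
  have "Ck_on (Suc 0) UNIV \<phi>" using \<phi> unfolding test_functions_def by blast
  then have d: "\<phi> differentiable (at x)" and c: "continuous_on UNIV (\<lambda>x. frechet_derivative \<phi> (at x) v)" for x v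
    by (auto simp: differentiable_on_def)
  obtain R where R: "\<And>x. norm x > R \<Longrightarrow> \<phi> x = 0"
    using Cc_support_bounded[OF test_function_imp_Cc[OF \<phi>]] by blast
  have z: "frechet_derivative \<phi> (at x) = (\<lambda>_. 0)" if "norm x > R" for x
  proof -
    have "(\<phi> has_derivative (\<lambda>_. 0)) (at x)"
    proof (rule has_derivative_transform_within_open[OF has_derivative_const])
      show "open (- cball (0::'a) R)" by (simp add: open_Compl)
    qed (use that R in auto)
    then show ?thesis by (rule frechet_derivative_at[symmetric])
  qed
  have "\<exists>M. \<forall>x. norm (frechet_derivative \<phi> (at x) v) \<le> M" for v
  proof -
    have "(\<lambda>x. frechet_derivative \<phi> (at x) v) \<in> Cc" by (rule Cc_I[where R = R]) (simp_all add: c z)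
    from Cc_bounded[OF this] show ?thesis by blast
  qed
  then have "\<forall>v. \<exists>M. \<forall>x. norm (frechet_derivative \<phi> (at x) v) \<le> M" ..
  from choice[OF this] obtain M where M: "\<And>x v. norm (frechet_derivative \<phi> (at x) v) \<le> M v" by blast
  have "norm (\<phi> x - \<phi> y) \<le> (\<Sum>b\<in>Basis. M b) * norm (x - y)" for x y
  proof (rule differentiable_bound[of UNIV])
    fix x :: 'a
    show D: "(\<phi> has_derivative frechet_derivative \<phi> (at x)) (at x within UNIV)"
      using d frechet_derivative_works by auto
    show "onorm (frechet_derivative \<phi> (at x)) \<le> (\<Sum>b\<in>Basis. M b)"
      using onorm_componentwise[OF has_derivative_bounded_linear[OF D]]
      by (rule order_trans) (intro sum_mono M)
  qed auto
  then show ?thesis by blast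
qed

lemma compact_exhaustion_covers:
  assumes K: "compact_exhaustion K" and S: "compact S"
  shows "\<exists>n. S \<subseteq> K n"
proof -
  have step: "K n \<subseteq> K (Suc n)" for n
    using K interior_subset unfolding compact_exhaustion_def by blast
  have mono: "K m \<subseteq> K n" if "m \<le> n" for m n
    using lift_Suc_mono_le[of K, OF step that] .
  have "S \<subseteq> (\<Union>n\<in>UNIV. interior (K (Suc n)))"
    using K unfolding compact_exhaustion_def by blast
  then obtain C where C: "finite C" "S \<subseteq> (\<Union>n\<in>C. interior (K (Suc n)))"
    using compactE_image[OF S, of UNIV "\<lambda>n. interior (K (Suc n))"] by auto
  have "interior (K (Suc n)) \<subseteq> K (Suc (Max C))" if "n \<in> C" for n
    using interior_subset mono[of "Suc n" "Suc (Max C)"] that C(1) by (auto dest: Max_ge)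
  then show ?thesis using C(2) by blast
qed

lemma ess_supp_subset_closure: "ess_supp f \<subseteq> closure {x. f x \<noteq> 0}"
proof -
  have "\<forall>x. x \<in> - closure {x. f x \<noteq> 0} \<longrightarrow> f x = 0"
    using closure_subset[of "{x. f x \<noteq> 0}"] by blast
  then have "AE x in lborel. x \<in> - closure {x. f x \<noteq> 0} \<longrightarrow> f x = 0" by (intro AE_I2) blast
  moreover have "open (- closure {x. f x \<noteq> 0})" by (intro open_Compl closed_closure)
  ultimately have "- closure {x. f x \<noteq> 0} \<subseteq> \<Union>{U. open U \<and> (AE x in lborel. x \<in> U \<longrightarrow> f x = 0)}"
    by (intro Union_upper) simp
  then show ?thesis unfolding ess_supp_def by blast
qed

lemma VMO_imp_VMO_c:
  assumes "compact_exhaustion K" "f \<in> VMO" "\<And>x. norm x > R \<Longrightarrow> f x = 0"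
  shows "f \<in> VMO_c K"
proof -
  obtain n where "cball 0 R \<subseteq> K n"
    using compact_exhaustion_covers[OF assms(1), of "cball 0 R"] by auto
  then have "ess_supp f \<subseteq> K n"
    using ess_supp_subset_closure[of f] closure_nonzero_subset_cball[of R f, OF assms(3)] by (meson order_trans)
  then show ?thesis using assms(2) by (auto simp: VMO_c_def VMO_on_def)
qed

lemma powr_le_one_add_powr:
  fixes b :: real
  assumes "0 \<le> b" "0 \<le> s" "s \<le> q"
  shows "b powr s \<le> 1 + b powr q"
proof (cases "b \<le> 1")
  case True
  then have "b powr s \<le> 1 powr s" using assms by (intro powr_mono2) auto
  then show ?thesis by (simp add: add_increasing2)
next
  case False
  then have "b powr s \<le> b powr q" using assms by (intro powr_mono) auto
  then show ?thesis by simp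
qed

lemma mult_le_one_add_powr:
  fixes a b :: real
  assumes "0 \<le> a" "0 \<le> b" "1 < p" "p / (p - 1) \<le> q"
  shows "a * b \<le> 1 + a powr p + b powr q"
proof (cases "b \<le> a powr (p - 1)")
  case True
  then have "a * b \<le> a * a powr (p - 1)" using assms by (intro mult_left_mono) auto
  also have "\<dots> = a powr p" using assms powr_add[of a 1 "p - 1"] by simp
  finally show ?thesis by (simp add: add_increasing add_increasing2)
next
  case False
  have "a = (a powr (p - 1)) powr (1 / (p - 1))" using assms by (simp add: powr_powr)
  also have "\<dots> \<le> b powr (1 / (p - 1))" using False assms by (intro powr_mono2) auto
  finally have "a * b \<le> b powr (1 / (p - 1)) * b" using assms by (intro mult_right_mono)
  also have "\<dots> = b powr (p / (p - 1))"
  proof -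
    have "1 / (p - 1) + 1 = p / (p - 1)" using assms by (simp add: field_simps)
    then show ?thesis using assms powr_add[of b "1 / (p - 1)" 1] by simp
  qed
  also have "\<dots> \<le> 1 + b powr q" using assms by (intro powr_le_one_add_powr) auto
  finally show ?thesis using powr_ge_zero[of a p] by linarith
qed

lemma borel_measurable_cnj [measurable]: "cnj \<in> borel_measurable borel"
  by (intro borel_measurable_continuous_onI continuous_intros)

lemma Linf_mult_Lp:
  assumes \<eta>: "\<eta> \<in> Linf" and f: "f \<in> Lp p" and p: "p \<ge> 0"
  shows "(\<lambda>x. \<eta> x * f x) \<in> Lp p"
proof -
  obtain C where [measurable]: "\<eta> \<in> borel_measurable borel" "f \<in> borel_measurable borel"
    and C: "AE x in lborel. norm (\<eta> x) \<le> C" and fi: "integrable lborel (\<lambda>x. norm (f x) powr p)"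
    using \<eta> f by (auto simp: Linf_def Lp_def)
  have "integrable lborel (\<lambda>x. norm (\<eta> x * f x) powr p)"
  proof (rule Bochner_Integration.integrable_bound)
    show "integrable lborel (\<lambda>x. C powr p * norm (f x) powr p)" using fi by simp
    show "AE x in lborel. norm (norm (\<eta> x * f x) powr p) \<le> norm (C powr p * norm (f x) powr p)"
      using C
    proof eventually_elim
      case (elim x)
      then have "norm (\<eta> x) powr p \<le> C powr p" using p by (intro powr_mono2) auto
      then show ?case by (simp add: norm_mult powr_mult mult_right_mono)
    qed
  qed measurable
  then show ?thesis by (simp add: Lp_def)
qed

lemma Lp_cnj: "f \<in> Lp p \<Longrightarrow> (\<lambda>x. cnj (f x)) \<in> Lp p"
  by (auto simp: Lp_def intro: measurable_compose[OF _ borel_measurable_cnj])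

lemma Linf_mult_Lp_bounded_support:
  fixes \<eta> f :: "'a::euclidean_space \<Rightarrow> complex"
  assumes \<eta>: "\<eta> \<in> Linf" and f: "f \<in> Lp p" and s: "0 < s" "s \<le> p" and supp: "\<And>x. norm x > R \<Longrightarrow> \<eta> x = 0"
  shows "(\<lambda>x. \<eta> x * f x) \<in> Lp s"
proof -
  obtain C where [measurable]: "\<eta> \<in> borel_measurable borel" "f \<in> borel_measurable borel"
    and C: "AE x in lborel. norm (\<eta> x) \<le> C" and fi: "integrable lborel (\<lambda>x. norm (f x) powr p)"
    using \<eta> f by (auto simp: Linf_def Lp_def)
  have "integrable lborel (\<lambda>x. norm (\<eta> x * f x) powr s)"
  proof (rule Bochner_Integration.integrable_bound)
    show "integrable lborel (\<lambda>x. C powr s * (indicator (cball (0::'a) R) x + norm (f x) powr p))"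
      using fi emeasure_lborel_cball_finite[of "0::'a" R]
      by (intro integrable_mult_right Bochner_Integration.integrable_add integrable_real_indicator) auto
    show "AE x in lborel. norm (norm (\<eta> x * f x) powr s) \<le> norm (C powr s * (indicator (cball 0 R) x + norm (f x) powr p))"
      using C
    proof eventually_elim
      case (elim x)
      show ?case
      proof (cases "norm x \<le> R")
        case True
        have "norm (\<eta> x) powr s \<le> C powr s" using s elim by (intro powr_mono2) auto
        then have "norm (\<eta> x) powr s * norm (f x) powr s \<le> C powr s * (1 + norm (f x) powr p)"
          using s by (intro mult_mono powr_le_one_add_powr) auto
        then show ?thesis using True by (simp add: norm_mult powr_mult abs_mult)
      qed (use supp s in auto)
    qed
  qed measurable
  then show ?thesis by (simp add: Lp_def)
qed

lemma integrable_Linf_mult_Lp_Lp: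
  fixes \<eta> f g :: "'a::euclidean_space \<Rightarrow> complex"
  assumes \<eta>: "\<eta> \<in> Linf" and f: "f \<in> Lp p" and g: "g \<in> Lp q" and pq: "1 < p" "p / (p - 1) \<le> q"
    and supp: "\<And>x. norm x > R \<Longrightarrow> \<eta> x = 0"
  shows "integrable lborel (\<lambda>x. \<eta> x * f x * cnj (g x))"
proof -
  obtain C where [measurable]: "\<eta> \<in> borel_measurable borel" "f \<in> borel_measurable borel" "g \<in> borel_measurable borel"
    and C: "AE x in lborel. norm (\<eta> x) \<le> C"
    and fi: "integrable lborel (\<lambda>x. norm (f x) powr p)" "integrable lborel (\<lambda>x. norm (g x) powr q)"
    using \<eta> f g by (auto simp: Linf_def Lp_def)
  show ?thesis
  proof (rule Bochner_Integration.integrable_bound)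
    show "integrable lborel (\<lambda>x. C * (indicator (cball (0::'a) R) x + norm (f x) powr p + norm (g x) powr q))"
      using fi emeasure_lborel_cball_finite[of "0::'a" R]
      by (intro integrable_mult_right Bochner_Integration.integrable_add integrable_real_indicator) auto
    show "AE x in lborel. norm (\<eta> x * f x * cnj (g x)) \<le> norm (C * (indicator (cball 0 R) x + norm (f x) powr p + norm (g x) powr q))"
      using C
    proof eventually_elim
      case (elim x)
      show ?case
      proof (cases "norm x \<le> R")
        case True
        have "norm (\<eta> x) * (norm (f x) * norm (g x)) \<le> C * (1 + norm (f x) powr p + norm (g x) powr q)"
          using elim pq order_trans[OF norm_ge_zero elim] by (intro mult_mono mult_le_one_add_powr) auto
        also have "\<dots> \<le> \<bar>C * (1 + norm (f x) powr p + norm (g x) powr q)\<bar>" by (rule abs_ge_self)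
        finally show ?thesis using True by (simp add: norm_mult mult.assoc)
      qed (use supp in auto)
    qed
  qed measurable
qed

lemma cutoff_in_Linf_VMO_c:
  assumes "compact_exhaustion K"
  shows "(\<lambda>x. complex_of_real (cutoff R x)) \<in> Linf \<inter> VMO_c K"
proof -
  have "(\<lambda>x. cutoff R x *\<^sub>R (1::complex)) \<in> Cc" by (intro Cc_mult_cutoff continuous_on_const)
  then have c: "(\<lambda>x. complex_of_real (cutoff R x)) \<in> Cc" by (simp add: scaleR_conv_of_real)
  have "complex_of_real (cutoff R x) = 0" if "norm x > R + 1" for x :: 'a
    using that by (simp add: cutoff_eq_0)
  then show ?thesis using VMO_imp_VMO_c[OF assms Cc_subset_VMO[OF c]] Cc_imp_Linf[OF c] by blast
qed

lemma weak_limit_product: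
  fixes \<psi> :: "'a::euclidean_space \<Rightarrow> complex"
  assumes p: "1 < p" and q: "1 < q" and pq: "1 / p + 1 / q < 1"
    and \<psi>: "\<psi> \<in> Linf" and supp: "\<And>x. norm x > R \<Longrightarrow> \<psi> x = 0"
    and u: "Lp_weakly_tendsto p us u" and v: "Lp_weakly_tendsto q vs v"
    and lim: "(\<lambda>n. LINT x|lborel. \<psi> x * us n x * cnj (vs n x)) \<longlonglongrightarrow> l"
  shows "(\<lambda>n. LINT x|lborel. \<psi> x * (us n x - u x) * cnj (vs n x - v x)) \<longlonglongrightarrow>
    l - (LINT x|lborel. \<psi> x * u x * cnj (v x))"
proof -
  have p': "p / (p - 1) \<le> q" "p / (p - 1) > 0" and q': "q / (q - 1) \<le> p" "q / (q - 1) > 0"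
    using p q pq by (simp_all add: field_simps)
  have uL: "us n \<in> Lp p" "u \<in> Lp p" and vL: "vs n \<in> Lp q" "v \<in> Lp q" for n
    using u v by (auto simp: Lp_weakly_tendsto_def)
  let ?P = "LINT x|lborel. \<psi> x * u x * cnj (v x)"
  note int = integrable_Linf_mult_Lp_Lp[OF \<psi> _ _ p p'(1) supp]
  have "(\<lambda>x. \<psi> x * cnj (v x)) \<in> Lp (p / (p - 1))"
    by (rule Linf_mult_Lp_bounded_support[OF \<psi> Lp_cnj[OF vL(2)] p'(2,1) supp])
  from bspec[OF conjunct2[OF conjunct2[OF u[unfolded Lp_weakly_tendsto_def]]] this]
  have "(\<lambda>n. LINT x|lborel. us n x * (\<psi> x * cnj (v x))) \<longlonglongrightarrow> (LINT x|lborel. u x * (\<psi> x * cnj (v x)))" .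
  then have lu: "(\<lambda>n. LINT x|lborel. \<psi> x * us n x * cnj (v x)) \<longlonglongrightarrow> ?P"
    by (simp add: mult_ac)
  have conj: "cnj (LINT x|lborel. g x * cnj (\<psi> x * u x)) = (LINT x|lborel. \<psi> x * u x * cnj (g x))" for g
    unfolding Bochner_Integration.integral_cnj[symmetric] by (rule Bochner_Integration.integral_cong) (simp_all add: mult_ac)
  have "(\<lambda>x. cnj (\<psi> x * u x)) \<in> Lp (q / (q - 1))"
    by (rule Lp_cnj[OF Linf_mult_Lp_bounded_support[OF \<psi> uL(2) q'(2,1) supp]])
  from bspec[OF conjunct2[OF conjunct2[OF v[unfolded Lp_weakly_tendsto_def]]] this]
  have "(\<lambda>n. LINT x|lborel. vs n x * cnj (\<psi> x * u x)) \<longlonglongrightarrow> (LINT x|lborel. v x * cnj (\<psi> x * u x))" .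
  from tendsto_cnj[OF this]
  have lv: "(\<lambda>n. LINT x|lborel. \<psi> x * u x * cnj (vs n x)) \<longlonglongrightarrow> ?P"
    by (simp only: conj)
  have "(LINT x|lborel. \<psi> x * (us n x - u x) * cnj (vs n x - v x)) =
      (LINT x|lborel. \<psi> x * us n x * cnj (vs n x)) - (LINT x|lborel. \<psi> x * us n x * cnj (v x)) -
      (LINT x|lborel. \<psi> x * u x * cnj (vs n x)) + ?P" for n
  proof -
    have "(LINT x|lborel. \<psi> x * (us n x - u x) * cnj (vs n x - v x)) =
      (LINT x|lborel. \<psi> x * us n x * cnj (vs n x) - \<psi> x * us n x * cnj (v x) -
        \<psi> x * u x * cnj (vs n x) + \<psi> x * u x * cnj (v x))"
      by (simp add: algebra_simps)
    also have "\<dots> = (LINT x|lborel. \<psi> x * us n x * cnj (vs n x)) - (LINT x|lborel. \<psi> x * us n x * cnj (v x)) -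
      (LINT x|lborel. \<psi> x * u x * cnj (vs n x)) + ?P"
      using int[OF uL(1)[of n] vL(1)[of n]] int[OF uL(1)[of n] vL(2)] int[OF uL(2) vL(1)[of n]] int[OF uL(2) vL(2)]
      by simp
    finally show ?thesis .
  qed
  moreover have "(\<lambda>n. (LINT x|lborel. \<psi> x * us n x * cnj (vs n x)) - (LINT x|lborel. \<psi> x * us n x * cnj (v x)) -
      (LINT x|lborel. \<psi> x * u x * cnj (vs n x)) + ?P) \<longlonglongrightarrow> l - ?P - ?P + ?P"
    by (intro tendsto_intros lim lu lv)
  ultimately show ?thesis by simp
qed

theorem theorem11:
  fixes p q :: real
    and K :: "nat \<Rightarrow> 'a::euclidean_space set"
    and Q u v :: "'a \<Rightarrow> complex"
    and us vs :: "nat \<Rightarrow> 'a \<Rightarrow> complex"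
    and \<omega> :: "('a \<Rightarrow> complex) \<Rightarrow> complex"
    and D :: "('a \<Rightarrow> complex) \<Rightarrow> ('a \<Rightarrow> complex) \<Rightarrow> complex"
    and r :: "nat \<Rightarrow> nat"
    and \<phi> :: "'a \<Rightarrow> complex"
  assumes "1 < p" and "1 < q" and "1 / p + 1 / q < 1"
    and "compact_exhaustion K"
    and "Q \<in> Linf \<inter> VMO"
    and "Lp_bounded p us" and "Lp_weakly_tendsto p us u"
    and "Lp_bounded q vs" and "Lp_weakly_tendsto q vs v"
    and "distribution \<omega>"
    and "tendsto_distribution (\<lambda>n x. qform Q x (us n x) (vs n x)) \<omega>"
    and "strict_mono r"
    and "H_distribution p q K (\<lambda>n x. us (r n) x - u x) (\<lambda>n x. vs (r n) x - v x) D"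
    and "\<phi> \<in> test_functions"
  shows "\<omega> \<phi> - pairing (\<lambda>x. qform Q x (u x) (v x)) \<phi> = D (\<lambda>x. Q x * \<phi> x) (\<lambda>_. 1)"
proof -
  have Q: "Q \<in> Linf \<inter> VMO" and K: "compact_exhaustion K" and \<phi>: "\<phi> \<in> test_functions" and p: "1 < p" by fact+
  define \<psi> where "\<psi> x = Q x * \<phi> x" for x
  have \<phi>c: "\<phi> \<in> Cc" by (rule test_function_imp_Cc[OF \<phi>])
  obtain L where "\<And>x y. norm (\<phi> x - \<phi> y) \<le> L * norm (x - y)"
    using test_function_Lipschitz[OF \<phi>] by blast
  then have \<psi>: "\<psi> \<in> Linf" "\<psi> \<in> VMO"
    using VMO_mult_Lipschitz[OF Q \<phi>c] unfolding \<psi>_def[abs_def] by auto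
  obtain R where R: "\<And>x. norm x > R \<Longrightarrow> \<phi> x = 0"
    using Cc_support_bounded[OF \<phi>c] by blast
  then have supp: "\<psi> x = 0" if "norm x > R" for x using that by (simp add: \<psi>_def)
  have \<psi>c: "\<psi> \<in> Linf \<inter> VMO_c K"
    using \<psi>(1) VMO_imp_VMO_c[OF K \<psi>(2) supp] by blast
  define \<eta> where "\<eta> x = complex_of_real (cutoff R x)" for x :: 'a
  have \<eta>c: "\<eta> \<in> Linf \<inter> VMO_c K"
    using cutoff_in_Linf_VMO_c[OF K] unfolding \<eta>_def[abs_def] .
  have \<psi>\<eta>: "\<psi> x * cnj (\<eta> x) = \<psi> x" for x
    using supp[of x] by (cases "norm x \<le> R") (auto simp: \<eta>_def cutoff_eq_1)
  let ?U = "\<lambda>n x. us (r n) x - u x" and ?V = "\<lambda>n x. vs (r n) x - v x"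
  have H: "H_distribution p q K ?U ?V D" by fact
  have UL: "?U n \<in> Lp p" and VL: "?V n \<in> Lp q" for n
    using H by (auto simp: H_distribution_def Lp_weakly_tendsto_def)
  have eq: "(LINT x|lborel. multiplier_op p (\<lambda>_. 1) (\<lambda>x. \<psi> x * ?U n x) x * cnj (\<eta> x * ?V n x)) =
      (LINT x|lborel. \<psi> x * ?U n x * cnj (?V n x))" for n
  proof (rule integral_cong_AE)
    have L: "(\<lambda>x. \<psi> x * ?U n x) \<in> Lp p" using p by (intro Linf_mult_Lp \<psi>(1) UL) simp
    have [measurable]: "\<psi> \<in> borel_measurable borel" "\<eta> \<in> borel_measurable borel"
      using \<psi>(1) \<eta>c by (auto simp: Linf_def)
    have [measurable]: "multiplier_op p (\<lambda>_. 1) (\<lambda>x. \<psi> x * ?U n x) \<in> borel_measurable borel"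
      using multiplier_op_one_in_Lp[OF _ L] p by (auto simp: Lp_def)
    have [measurable]: "?U n \<in> borel_measurable borel" "?V n \<in> borel_measurable borel"
      using UL[of n] VL[of n] by (auto simp: Lp_def)
    show "(\<lambda>x. multiplier_op p (\<lambda>_. 1) (\<lambda>x. \<psi> x * ?U n x) x * cnj (\<eta> x * ?V n x)) \<in> borel_measurable lborel"
      "(\<lambda>x. \<psi> x * ?U n x * cnj (?V n x)) \<in> borel_measurable lborel"
      by measurable
    have "AE x in lborel. multiplier_op p (\<lambda>_. 1) (\<lambda>x. \<psi> x * ?U n x) x = \<psi> x * ?U n x"
      using p by (intro multiplier_op_one_AE L) simp
    then show "AE x in lborel. multiplier_op p (\<lambda>_. 1) (\<lambda>x. \<psi> x * ?U n x) x * cnj (\<eta> x * ?V n x) =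
        \<psi> x * ?U n x * cnj (?V n x)"
    proof eventually_elim
      case (elim x)
      have "multiplier_op p (\<lambda>_. 1) (\<lambda>x. \<psi> x * ?U n x) x * cnj (\<eta> x * ?V n x) =
          (\<psi> x * cnj (\<eta> x)) * ?U n x * cnj (?V n x)"
        unfolding elim by (simp add: mult_ac)
      then show ?case by (simp only: \<psi>\<eta>)
    qed
  qed
  have "(\<lambda>n. LINT x|lborel. multiplier_op p (\<lambda>_. 1) (\<lambda>x. \<psi> x * ?U n x) x * cnj (\<eta> x * ?V n x))
      \<longlonglongrightarrow> D (\<lambda>x. \<psi> x * cnj (\<eta> x)) (\<lambda>_. 1)"
    using H \<psi>c \<eta>c one_in_Ck_sphere unfolding H_distribution_def by blast
  then have limD: "(\<lambda>n. LINT x|lborel. \<psi> x * ?U n x * cnj (?V n x)) \<longlonglongrightarrow> D \<psi> (\<lambda>_. 1)"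
    by (simp only: eq \<psi>\<eta>)
  have "(\<lambda>n. pairing (\<lambda>x. qform Q x (us n x) (vs n x)) \<phi>) \<longlonglongrightarrow> \<omega> \<phi>"
    using assms(11) \<phi> by (simp add: tendsto_distribution_def)
  then have "(\<lambda>n. LINT x|lborel. \<psi> x * us n x * cnj (vs n x)) \<longlonglongrightarrow> \<omega> \<phi>"
    by (simp add: pairing_def qform_def \<psi>_def mult_ac)
  from LIMSEQ_subseq_LIMSEQ[OF weak_limit_product[OF assms(1-3) \<psi>(1) supp assms(7,9) this] assms(12)]
  have "(\<lambda>n. LINT x|lborel. \<psi> x * ?U n x * cnj (?V n x)) \<longlonglongrightarrow>
      \<omega> \<phi> - (LINT x|lborel. \<psi> x * u x * cnj (v x))"
    by (simp add: o_def)
  from LIMSEQ_unique[OF this limD]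
  show ?thesis by (simp add: pairing_def qform_def \<psi>_def[abs_def] mult_ac)
qed

end
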